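(* Let $A=A_s+A_d\epsilon\in\mathbb{D}^{m\times n}$ and let $A_1=(A_sA_s^+)A(A_s^+A_s)$. Then the DMPGI of $A_1$ exists and $$A^P=A_1^P=A_1^D=A_1^G.$$
   Context: A dual real matrix is $A=A_s+A_d\epsilon$ with real matrices $A_s,A_d$, $\epsilon\neq0$, $\epsilon^2=0$; $A^\top=A_s^\top+A_d^\top\epsilon$. $A_s^+$ is the Moore–Penrose inverse of the real matrix $A_s$. The Moore–Penrose dual generalized inverse (MPDGI) is $A^P=A_s^+-A_s^+A_dA_s^+\epsilon$. The DMPGI $B^D$ of a dual real matrix $B$ is a matrix $X$ with $BXB=B$, $XBX=X$, $(BX)^\top=BX$, $(XB)^\top=XB$. Every dual real matrix has an SVD $B=U\Sigma V^\top$ with $U,V$ orthogonal dual real and $\Sigma$ diagonal with entries $\mu_1\ge\dots\ge\mu_r$ positive appreciable (nonzero standard part), $\mu_{r+1}\ge\dots\ge\mu_t$ positive infinitesimal (zero standard part), and zeros; the essential part is $B_e=U\begin{bmatrix}\mathrm{diag}(\mu_1,\dots,\mu_r)&O\\O&O\end{bmatrix}V^\top$, and the GMPI $B^G$ is the unique $X$ with $BXB=B_e$, $XBX=X$, $(BX)^\top=BX$, $(XB)^\top=XB$. *)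

theory Defs
  imports "Jordan_Normal_Form.Matrix"
begin

text \<open>Real matrices are Jordan_Normal_Form matrices of type real mat.
A dual real matrix A = A_s + A_d eps is represented as the pair (A_s, A_d).\<close>

type_synonym dmat = "real mat \<times> real mat"

definition dcarrier :: "nat \<Rightarrow> nat \<Rightarrow> dmat set" where
  "dcarrier m n = {A. fst A \<in> carrier_mat m n \<and> snd A \<in> carrier_mat m n}"

definition dmult :: "dmat \<Rightarrow> dmat \<Rightarrow> dmat" where
  "dmult A B = (fst A * fst B, fst A * snd B + snd A * fst B)"

definition dtrans :: "dmat \<Rightarrow> dmat" where
  "dtrans A = (transpose_mat (fst A), transpose_mat (snd A))"

definition dreal :: "real mat \<Rightarrow> dmat" where
  "dreal R = (R, 0\<^sub>m (dim_row R) (dim_col R))"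

definition did :: "nat \<Rightarrow> dmat" where
  "did n = (1\<^sub>m n, 0\<^sub>m n n)"

definition mp_inv :: "real mat \<Rightarrow> real mat" where
  "mp_inv A = (THE X. X \<in> carrier_mat (dim_col A) (dim_row A) \<and>
      A * X * A = A \<and> X * A * X = X \<and>
      transpose_mat (A * X) = A * X \<and> transpose_mat (X * A) = X * A)"

definition mpdgi :: "dmat \<Rightarrow> dmat" where
  "mpdgi A = (mp_inv (fst A), - (mp_inv (fst A) * snd A * mp_inv (fst A)))"

definition is_dmpgi :: "dmat \<Rightarrow> dmat \<Rightarrow> bool" where
  "is_dmpgi B X \<longleftrightarrow> X \<in> dcarrier (dim_col (fst B)) (dim_row (fst B)) \<and>
     dmult (dmult B X) B = B \<and> dmult (dmult X B) X = X \<and>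
     dtrans (dmult B X) = dmult B X \<and> dtrans (dmult X B) = dmult X B"

definition dmpgi_exists :: "dmat \<Rightarrow> bool" where
  "dmpgi_exists B \<longleftrightarrow> (\<exists>X. is_dmpgi B X)"

definition dmpgi :: "dmat \<Rightarrow> dmat" where
  "dmpgi B = (THE X. is_dmpgi B X)"

definition dual_le :: "real \<times> real \<Rightarrow> real \<times> real \<Rightarrow> bool" where
  "dual_le a b \<longleftrightarrow> fst a < fst b \<or> (fst a = fst b \<and> snd a \<le> snd b)"

definition dorthogonal :: "nat \<Rightarrow> dmat \<Rightarrow> bool" where
  "dorthogonal n U \<longleftrightarrow> U \<in> dcarrier n n \<and> dmult (dtrans U) U = did n \<and> dmult U (dtrans U) = did n"

definition ddiag_entry :: "dmat \<Rightarrow> nat \<Rightarrow> real \<times> real" where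
  "ddiag_entry S i = (fst S $$ (i, i), snd S $$ (i, i))"

definition dsvd_sigma :: "nat \<Rightarrow> nat \<Rightarrow> dmat \<Rightarrow> bool" where
  "dsvd_sigma m n S \<longleftrightarrow> S \<in> dcarrier m n \<and>
     (\<forall>i<m. \<forall>j<n. i \<noteq> j \<longrightarrow> fst S $$ (i, j) = 0 \<and> snd S $$ (i, j) = 0) \<and>
     (\<exists>r t. r \<le> t \<and> t \<le> min m n \<and>
        (\<forall>i<r. fst S $$ (i, i) > 0) \<and>
        (\<forall>i. r \<le> i \<and> i < t \<longrightarrow> fst S $$ (i, i) = 0 \<and> snd S $$ (i, i) > 0) \<and>
        (\<forall>i. t \<le> i \<and> i < min m n \<longrightarrow> fst S $$ (i, i) = 0 \<and> snd S $$ (i, i) = 0)) \<and>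
     (\<forall>i j. i \<le> j \<and> j < min m n \<longrightarrow> dual_le (ddiag_entry S j) (ddiag_entry S i))"

definition dsvd :: "dmat \<Rightarrow> dmat \<Rightarrow> dmat \<Rightarrow> dmat \<Rightarrow> bool" where
  "dsvd B U S V \<longleftrightarrow> (let m = dim_row (fst B); n = dim_col (fst B) in
     dorthogonal m U \<and> dorthogonal n V \<and> dsvd_sigma m n S \<and>
     B = dmult (dmult U S) (dtrans V))"

definition ess_sigma :: "dmat \<Rightarrow> dmat" where
  "ess_sigma S = (let m = dim_row (fst S); n = dim_col (fst S) in
     (mat m n (\<lambda>(i, j). if i = j \<and> fst S $$ (i, i) \<noteq> 0 then fst S $$ (i, j) else 0),
      mat m n (\<lambda>(i, j). if i = j \<and> fst S $$ (i, i) \<noteq> 0 then snd S $$ (i, j) else 0)))"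

definition essential_part :: "dmat \<Rightarrow> dmat" where
  "essential_part B = (SOME Be. \<exists>U S V. dsvd B U S V \<and> Be = dmult (dmult U (ess_sigma S)) (dtrans V))"

definition gmpi :: "dmat \<Rightarrow> dmat" where
  "gmpi B = (THE X. X \<in> dcarrier (dim_col (fst B)) (dim_row (fst B)) \<and>
     dmult (dmult B X) B = essential_part B \<and> dmult (dmult X B) X = X \<and>
     dtrans (dmult B X) = dmult B X \<and> dtrans (dmult X B) = dmult X B)"

end

theory Submission
  imports Defs "Jordan_Normal_Form.Determinant" "HOL-Analysis.Function_Topology"
begin

text \<open>
Write A1 = (A, E) with E = P E Q, where P and Q are the orthogonal projections A Y and Y A for the
Moore-Penrose inverse Y of A. The four Penrose equations for the MPDGI of A1 are then a direct
computation, and Penrose's argument gives uniqueness over the dual numbers as well. The GMPI agrees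
with the DMPGI once the essential part of A1 is A1 itself. If S is the middle factor of any dual SVD
of A1, the Penrose equation becomes S Z S = S, and a diagonal entry of S with zero standard part
squares to zero, so it vanishes: there is nothing infinitesimal to remove.

Since the essential part is a Hilbert choice, at least one dual SVD must be exhibited. Pick
orthonormal vectors successively as lexicographic maximisers of the quadratic forms of A^T A and
A^T E + E^T A. This gives orthogonal U, V with U^T A V diagonal such that C = U^T E V has
a skew off-diagonal part and decreasing diagonal wherever singular values of A coincide. The remaining
off-diagonal entries of C are removed by infinitesimal rotations U (1 + K eps) and V (1 + L eps) with
skew K, L, which are found by solving a 2x2 linear system for every pair of indices.
\<close>

section \<open>Orthonormal systems\<close>

text \<open>Vectors are functions on all of \<open>nat\<close> of which only the first
  \<open>n\<close> coordinates count. This one type serves every dimension and carries the product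
  topology used for compactness.\<close>

definition ip :: "nat \<Rightarrow> (nat \<Rightarrow> real) \<Rightarrow> (nat \<Rightarrow> real) \<Rightarrow> real" where
  "ip n x y = (\<Sum>i<n. x i * y i)"

definition apply_form :: "nat \<Rightarrow> (nat \<Rightarrow> nat \<Rightarrow> real) \<Rightarrow> (nat \<Rightarrow> real) \<Rightarrow> nat \<Rightarrow> real" where
  "apply_form n H x i = (\<Sum>j<n. H i j * x j)"

definition orthonormal :: "nat \<Rightarrow> nat \<Rightarrow> (nat \<Rightarrow> nat \<Rightarrow> real) \<Rightarrow> bool" where
  "orthonormal n k v \<longleftrightarrow> (\<forall>i<k. \<forall>j<k. ip n (v i) (v j) = (if i = j then 1 else 0))"

lemma ip_commute: "ip n x y = ip n y x"
  by (simp add: ip_def mult.commute)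

lemma ip_add_right: "ip n x (\<lambda>i. y i + z i) = ip n x y + ip n x z"
  by (simp add: ip_def algebra_simps sum.distrib)

lemma ip_add_left: "ip n (\<lambda>i. y i + z i) x = ip n y x + ip n z x"
  by (simp add: ip_def algebra_simps sum.distrib)

lemma ip_diff_right: "ip n x (\<lambda>i. y i - z i) = ip n x y - ip n x z"
  by (simp add: ip_def algebra_simps sum_subtractf)

lemma ip_diff_left: "ip n (\<lambda>i. y i - z i) x = ip n y x - ip n z x"
  by (simp add: ip_def algebra_simps sum_subtractf)

lemma ip_scale_right: "ip n x (\<lambda>i. c * y i) = c * ip n x y"
  by (simp add: ip_def algebra_simps sum_distrib_left)

lemma ip_scale_left: "ip n (\<lambda>i. c * y i) x = c * ip n y x"
  by (simp add: ip_def algebra_simps sum_distrib_left)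

lemma ip_sum_right: "ip n x (\<lambda>i. \<Sum>l\<in>L. a l * v l i) = (\<Sum>l\<in>L. a l * ip n x (v l))"
  unfolding ip_def sum_distrib_left by (subst sum.swap) (simp add: algebra_simps)

lemmas ip_linear = ip_add_right ip_add_left ip_diff_right ip_diff_left ip_scale_right ip_scale_left

lemma ip_cong:
  assumes "\<And>i. i < n \<Longrightarrow> x i = x' i" "\<And>i. i < n \<Longrightarrow> y i = y' i"
  shows "ip n x y = ip n x' y'"
  unfolding ip_def using assms by (intro sum.cong) auto

lemma ip_self_nonneg: "0 \<le> ip n x x"
  by (simp add: ip_def sum_nonneg)

lemma ip_self_eq_0: "ip n x x = 0 \<longleftrightarrow> (\<forall>i<n. x i = 0)"
  by (auto simp: ip_def sum_nonneg_eq_0_iff)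

lemma apply_form_add: "apply_form n H (\<lambda>i. x i + y i) = (\<lambda>i. apply_form n H x i + apply_form n H y i)"
  by (auto simp: apply_form_def algebra_simps sum.distrib)

lemma apply_form_scale: "apply_form n H (\<lambda>i. c * x i) = (\<lambda>i. c * apply_form n H x i)"
  by (auto simp: apply_form_def algebra_simps sum_distrib_left)

lemma apply_form_cong:
  assumes "\<And>i. i < n \<Longrightarrow> x i = x' i"
  shows "apply_form n H x = apply_form n H x'"
  unfolding apply_form_def using assms by (intro ext sum.cong) auto

lemma ip_apply_form_commute:
  assumes "\<And>i j. i < n \<Longrightarrow> j < n \<Longrightarrow> H i j = H j i"
  shows "ip n x (apply_form n H y) = ip n (apply_form n H x) y"
proof -
  have "ip n x (apply_form n H y) = (\<Sum>i<n. \<Sum>j<n. x i * (H i j * y j))"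
    by (simp add: ip_def apply_form_def sum_distrib_left)
  also have "\<dots> = (\<Sum>j<n. \<Sum>i<n. x i * (H i j * y j))"
    by (rule sum.swap)
  also have "\<dots> = (\<Sum>j<n. \<Sum>i<n. H j i * x i * y j)"
    using assms by (intro sum.cong) auto
  finally show ?thesis
    by (simp add: ip_def apply_form_def sum_distrib_right)
qed

text \<open>\<open>res x\<close> is \<open>x\<close> minus its orthogonal projection to the span of
  the \<open>v l\<close>. The second claim is Pythagoras; as its left side is nonnegative, it
  contains Bessel's inequality.\<close>

lemma orthonormal_residual:
  assumes "orthonormal n k v"
  defines "res \<equiv> \<lambda>x i. x i - (\<Sum>l<k. ip n x (v l) * v l i)"
  shows "\<And>l. l < k \<Longrightarrow> ip n (v l) (res x) = 0"
    and "ip n (res x) (res x) = ip n x x - (\<Sum>l<k. (ip n x (v l))\<^sup>2)"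
proof -
  show orth: "ip n (v l) (res x) = 0" if "l < k" for l x
  proof -
    have "(\<Sum>j<k. ip n x (v j) * ip n (v l) (v j)) = (\<Sum>j<k. if j = l then ip n x (v l) else 0)"
      using assms(1) that by (intro sum.cong) (auto simp: orthonormal_def)
    then show ?thesis
      using that by (simp add: res_def ip_linear ip_sum_right ip_commute)
  qed
  have "ip n (res x) (\<lambda>i. \<Sum>l<k. ip n x (v l) * v l i) = 0"
    using orth by (simp add: ip_sum_right ip_commute[of n "res x"])
  then have "ip n (res x) (res x) = ip n (res x) x"
    by (subst (2) res_def) (simp add: ip_linear)
  also have "\<dots> = ip n x x - (\<Sum>l<k. (ip n x (v l))\<^sup>2)"
    by (simp add: ip_commute[of n "res x"]) (simp add: res_def ip_linear ip_sum_right power2_eq_square)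
  finally show "ip n (res x) (res x) = ip n x x - (\<Sum>l<k. (ip n x (v l))\<^sup>2)" .
qed

text \<open>Summing the squared entries by coordinates instead of by vectors computes the trace of
  the projection onto the span. Comparing this trace with \<open>n\<close> replaces dimension theory
  below.\<close>

lemma orthonormal_sum_squares:
  assumes "orthonormal n k v"
  shows "(\<Sum>j<n. \<Sum>l<k. (v l j)\<^sup>2) = real k"
proof -
  have "(\<Sum>j<n. \<Sum>l<k. (v l j)\<^sup>2) = (\<Sum>l<k. ip n (v l) (v l))"
    unfolding ip_def power2_eq_square by (rule sum.swap)
  also have "\<dots> = real k"
    using assms by (simp add: orthonormal_def)
  finally show ?thesis .
qed

lemma ip_unit_left: "j < n \<Longrightarrow> ip n (\<lambda>i. if i = j then 1 else 0) x = x j"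
  by (simp add: ip_def if_distrib[of "\<lambda>t. t * _"] cong: if_cong)

text \<open>Bessel's inequality for the standard basis vectors bounds each coordinate's share of the
  trace \<open>k\<close> by 1.\<close>

lemma orthonormal_card_le:
  assumes "orthonormal n k v"
  shows "k \<le> n"
proof -
  have "(\<Sum>l<k. (v l j)\<^sup>2) \<le> 1" if "j < n" for j
    using orthonormal_residual(2)[OF assms, of "\<lambda>i. if i = j then 1 else 0"] that
      ip_self_nonneg[of n "\<lambda>i. (if i = j then 1 else 0) - (\<Sum>l<k. ip n (\<lambda>i. if i = j then 1 else 0) (v l) * v l i)"]
    by (simp add: ip_unit_left)
  then have "(\<Sum>j<n. \<Sum>l<k. (v l j)\<^sup>2) \<le> (\<Sum>j<n. 1)"
    by (intro sum_mono) auto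
  then show ?thesis
    using orthonormal_sum_squares[OF assms] by simp
qed

text \<open>Since the trace \<open>k\<close> is less than \<open>n\<close>, some standard basis
  vector has a nonzero residual. Normalising that residual gives the new vector.\<close>

lemma orthonormal_extend:
  assumes "orthonormal n k v" "k < n"
  obtains x where "ip n x x = 1" "\<And>l. l < k \<Longrightarrow> ip n (v l) x = 0"
proof -
  have "\<exists>j<n. (\<Sum>l<k. (v l j)\<^sup>2) \<noteq> 1"
  proof (rule ccontr)
    assume "\<not> ?thesis"
    then have "(\<Sum>j<n. \<Sum>l<k. (v l j)\<^sup>2) = real n" by simp
    then show False using orthonormal_sum_squares[OF assms(1)] assms(2) by simp
  qed
  then obtain j where j: "j < n" "(\<Sum>l<k. (v l j)\<^sup>2) \<noteq> 1" by blast
  define e :: "nat \<Rightarrow> real" where "e = (\<lambda>i. if i = j then 1 else 0)"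
  define y where "y = (\<lambda>i. e i - (\<Sum>l<k. ip n e (v l) * v l i))"
  have orth: "\<And>l. l < k \<Longrightarrow> ip n (v l) y = 0"
    unfolding y_def by (rule orthonormal_residual(1)[OF assms(1)])
  have "ip n y y = 1 - (\<Sum>l<k. (v l j)\<^sup>2)"
    unfolding y_def orthonormal_residual(2)[OF assms(1)] using j(1) by (simp add: e_def ip_unit_left)
  then have pos: "ip n y y > 0"
    using j(2) ip_self_nonneg[of n y] by linarith
  show ?thesis
  proof
    show "ip n (\<lambda>i. inverse (sqrt (ip n y y)) * y i) (\<lambda>i. inverse (sqrt (ip n y y)) * y i) = 1"
      using pos unfolding ip_linear by (simp add: field_simps)
    show "ip n (v l) (\<lambda>i. inverse (sqrt (ip n y y)) * y i) = 0" if "l < k" for l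
      using orth[OF that] by (simp add: ip_linear)
  qed
qed

lemma orthonormal_fun_upd:
  assumes "orthonormal n k v" "ip n x x = 1" "\<And>l. l < k \<Longrightarrow> ip n (v l) x = 0"
  shows "orthonormal n (Suc k) (v(k := x))"
  using assms by (auto simp: orthonormal_def less_Suc_eq ip_commute[of n x "v _"])

lemma orthonormal_complete:
  assumes "orthonormal n k v"
  obtains u where "orthonormal n n u" "\<And>l. l < k \<Longrightarrow> u l = v l"
proof -
  have "k \<le> p \<Longrightarrow> p \<le> n \<Longrightarrow> \<exists>u. orthonormal n p u \<and> (\<forall>l<k. u l = v l)" for p
  proof (induction p rule: dec_induct)
    case base
    then show ?case using assms by blast
  next
    case (step p)
    then obtain u where u: "orthonormal n p u" "\<forall>l<k. u l = v l" by auto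
    obtain x where "ip n x x = 1" "\<And>l. l < p \<Longrightarrow> ip n (u l) x = 0"
      using orthonormal_extend[OF u(1)] step.prems by auto
    then have "orthonormal n (Suc p) (u(p := x))"
      by (rule orthonormal_fun_upd[OF u(1)])
    moreover have "\<forall>l<k. (u(p := x)) l = v l"
      using u(2) step.hyps by auto
    ultimately show ?case by blast
  qed
  from this[OF orthonormal_card_le[OF assms] order_refl] show ?thesis
    using that by auto
qed

section \<open>Lexicographic spectral bases\<close>

text \<open>First \<open>f\<close> is maximised on \<open>K\<close>, then \<open>g\<close> on the
  set of maximisers of \<open>f\<close>, which is again compact.\<close>

lemma compact_lexicographic_maximum:
  fixes f g :: "'a::topological_space \<Rightarrow> real"
  assumes "compact K" "K \<noteq> {}" "continuous_on K f" "continuous_on K g"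
  obtains w where "w \<in> K" "\<And>x. x \<in> K \<Longrightarrow> f x \<le> f w"
    "\<And>x. x \<in> K \<Longrightarrow> f x = f w \<Longrightarrow> g x \<le> g w"
proof -
  obtain w0 where w0: "w0 \<in> K" "\<And>x. x \<in> K \<Longrightarrow> f x \<le> f w0"
    using continuous_attains_sup[OF assms(1,2,3)] by auto
  let ?K = "K \<inter> f -` {f w0}"
  have "compact ?K"
    using continuous_closedin_preimage[OF assms(3) closed_singleton] assms(1) closedin_compact by blast
  moreover have "?K \<noteq> {}"
    using w0 by auto
  moreover have "continuous_on ?K g"
    by (rule continuous_on_subset[OF assms(4)]) auto
  ultimately obtain w where "w \<in> ?K" "\<forall>x\<in>?K. g x \<le> g w"
    using continuous_attains_sup by blast
  with w0 show ?thesis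
    by (intro that[of w]) auto
qed

text \<open>In the product topology a cube is compact by Tychonoff. The set is closed and lies in
  the cube with sides \<open>{-1..1}\<close>, because the coordinates from \<open>n\<close> on are
  forced to vanish.\<close>

lemma compact_unit_sphere_of_complement:
  "compact {x. (\<forall>i\<ge>n. x i = 0) \<and> ip n x x = 1 \<and> (\<forall>l<k. ip n (v l) x = 0)}"
proof -
  have cont: "continuous_on UNIV (\<lambda>x::nat \<Rightarrow> real. x i)" for i
    by simp
  have "compactin (product_topology (\<lambda>i. euclidean) UNIV) (PiE UNIV (\<lambda>i::nat. {-1..1::real}))"
    by (subst compactin_PiE) auto
  then have "compact (PiE UNIV (\<lambda>i::nat. {-1..1::real}))"
    by (metis compactin_euclidean_iff euclidean_product_topology)
  moreover have "closed ({x. \<forall>i\<ge>n. x i = (0::real)} \<inter> {x. ip n x x = 1} \<inter> {x. \<forall>l<k. ip n (v l) x = 0})"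
    unfolding ip_def
    by (intro closed_Int closed_Collect_all closed_Collect_imp closed_Collect_eq open_Collect_const
        continuous_on_sum continuous_on_mult continuous_on_const cont)
  ultimately have "compact (PiE UNIV (\<lambda>i::nat. {-1..1::real}) \<inter>
      ({x. \<forall>i\<ge>n. x i = (0::real)} \<inter> {x. ip n x x = 1} \<inter> {x. \<forall>l<k. ip n (v l) x = 0}))"
    by (rule compact_Int_closed)
  moreover have "x i \<in> {-1..1}" if "\<forall>i\<ge>n. x i = 0" "ip n x x = 1" for x :: "nat \<Rightarrow> real" and i
  proof (cases "i < n")
    case True
    then have "x i * x i \<le> ip n x x"
      unfolding ip_def by (intro member_le_sum) auto
    then have "\<bar>x i\<bar> \<le> 1"
      using that by (simp add: abs_square_le_1[symmetric] power2_eq_square)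
    then show ?thesis by auto
  qed (use that in auto)
  ultimately show ?thesis
    by (elim back_subst[of compact]) (auto simp: PiE_def)
qed

text \<open>For small \<open>t\<close> a nonzero linear term beats the quadratic one. With
  \<open>B > 0\<close> and \<open>b < B\<close>, the choice \<open>t = a / B\<close> would give
  \<open>a\<^sup>2 / B < a\<^sup>2 / B\<close>.\<close>

lemma linear_term_zero_if_dominated:
  fixes a b :: real
  assumes "\<And>t. t * a \<le> t\<^sup>2 * b"
  shows "a = 0"
proof (rule ccontr)
  assume "a \<noteq> 0"
  define B where "B = \<bar>b\<bar> + 1"
  have "a\<^sup>2 / B \<le> (a / B)\<^sup>2 * b"
    using assms[of "a / B"] by (simp add: power2_eq_square)
  moreover have "B > 0" "b < B" by (auto simp: B_def)
  moreover have "(a / B)\<^sup>2 * b < (a / B)\<^sup>2 * B"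
    using \<open>a \<noteq> 0\<close> \<open>B > 0\<close> \<open>b < B\<close> by (intro mult_strict_left_mono) auto
  ultimately show False
    by (simp add: power2_eq_square)
qed

text \<open>First variation: on the subspace \<open>W\<close> the form
  \<open>c * ip n x x - ip n x (apply_form n H x)\<close> is nonnegative and vanishes at
  \<open>w\<close>, so its linear term along \<open>w + t z\<close> is zero. \<open>W\<close> is
  kept abstract because it will be an orthogonal complement and then an eigenspace inside
  it.\<close>

lemma form_maximizer_stationary:
  assumes sym: "\<And>i j. i < n \<Longrightarrow> j < n \<Longrightarrow> H i j = H j i"
    and add: "\<And>x y. x \<in> W \<Longrightarrow> y \<in> W \<Longrightarrow> (\<lambda>i. x i + y i) \<in> W"
    and scale: "\<And>c x. x \<in> W \<Longrightarrow> (\<lambda>i. c * x i) \<in> W"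
    and max: "\<And>x. x \<in> W \<Longrightarrow> ip n x x = 1 \<Longrightarrow> ip n x (apply_form n H x) \<le> ip n w (apply_form n H w)"
    and w: "w \<in> W" "ip n w w = 1" and z: "z \<in> W"
  shows "ip n z (apply_form n H w) = ip n w (apply_form n H w) * ip n z w"
proof -
  define c where "c = ip n w (apply_form n H w)"
  \<comment> \<open>By homogeneity the bound passes from unit vectors to all of \<open>W\<close>, so
    that \<open>w + t z\<close> need not be normalised.\<close>
  have hom: "ip n x (apply_form n H x) \<le> c * ip n x x" if "x \<in> W" for x
  proof (cases "ip n x x = 0")
    case True
    then have "ip n x (apply_form n H x) = ip n (\<lambda>i. 0) (apply_form n H x)"
      by (intro ip_cong) (auto simp: ip_self_eq_0)
    then show ?thesis
      using True by (simp add: ip_def)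
  next
    case False
    then have pos: "ip n x x > 0" using ip_self_nonneg[of n x] by linarith
    let ?s = "inverse (sqrt (ip n x x))"
    have "ip n (\<lambda>i. ?s * x i) (\<lambda>i. ?s * x i) = 1"
      using pos unfolding ip_linear by (simp add: field_simps)
    from max[OF scale[OF that] this] have "?s * (?s * ip n x (apply_form n H x)) \<le> c"
      unfolding c_def apply_form_scale ip_linear .
    then show ?thesis
      using pos by (simp add: field_simps)
  qed
  have "2 * (ip n z (apply_form n H w) - c * ip n z w) = 0"
  proof (rule linear_term_zero_if_dominated)
    fix t :: real
    have "(\<lambda>i. w i + t * z i) \<in> W" using add scale w z by blast
    from hom[OF this]
    have "ip n w (apply_form n H w) + t * ip n z (apply_form n H w) + t * ip n w (apply_form n H z)
        + t * (t * ip n z (apply_form n H z))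
      \<le> c * (1 + t * ip n z w + t * ip n w z + t * (t * ip n z z))"
      by (simp add: apply_form_add apply_form_scale ip_linear w algebra_simps)
    moreover have "ip n w (apply_form n H z) = ip n z (apply_form n H w)"
      using ip_apply_form_commute[of n H w z] sym by (simp add: ip_commute)
    ultimately show "t * (2 * (ip n z (apply_form n H w) - c * ip n z w)) \<le>
        t\<^sup>2 * (c * ip n z z - ip n z (apply_form n H z))"
      unfolding c_def[symmetric] ip_commute[of n w z] by (simp add: algebra_simps power2_eq_square)
  qed
  then show ?thesis by (simp add: c_def)
qed

definition rayleigh :: "nat \<Rightarrow> (nat \<Rightarrow> nat \<Rightarrow> real) \<Rightarrow> (nat \<Rightarrow> real) \<Rightarrow> real" where
  "rayleigh n H x = ip n x (apply_form n H x)"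

definition eigen :: "nat \<Rightarrow> (nat \<Rightarrow> nat \<Rightarrow> real) \<Rightarrow> real \<Rightarrow> (nat \<Rightarrow> real) \<Rightarrow> bool" where
  "eigen n H c x \<longleftrightarrow> (\<forall>i<n. apply_form n H x i = c * x i)"

lemma eigen_ip: "eigen n H c x \<Longrightarrow> ip n y (apply_form n H x) = c * ip n y x"
  unfolding ip_scale_right[symmetric] eigen_def by (intro ip_cong) auto

lemma eigen_add: "eigen n H c x \<Longrightarrow> eigen n H c y \<Longrightarrow> eigen n H c (\<lambda>i. x i + y i)"
  by (simp add: eigen_def apply_form_add algebra_simps)

lemma eigen_scale: "eigen n H c x \<Longrightarrow> eigen n H c (\<lambda>i. a * x i)"
  by (simp add: eigen_def apply_form_scale)

lemma continuous_on_rayleigh: "continuous_on K (rayleigh n H)"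
proof -
  have cont: "continuous_on K (\<lambda>x::nat \<Rightarrow> real. x i)" for i
    by (rule continuous_on_subset[OF continuous_on_product_coordinates]) auto
  show ?thesis
    unfolding rayleigh_def ip_def apply_form_def
    by (intro continuous_on_sum continuous_on_mult continuous_on_const cont)
qed

text \<open>\<open>w\<close> maximises the form of \<open>H\<close> on the unit sphere of the
  complement of the \<open>v l\<close>, with ties broken by the form of \<open>G\<close>.
  Stationarity for \<open>H\<close> makes \<open>w\<close> an eigenvector; stationarity for
  \<open>G\<close> inside the eigenspace makes \<open>apply_form n G w\<close> orthogonal to the
  rest of that eigenspace.\<close>

lemma lexicographic_eigenvector_step:
  assumes symH: "\<And>i j. i < n \<Longrightarrow> j < n \<Longrightarrow> H i j = H j i"
    and symG: "\<And>i j. i < n \<Longrightarrow> j < n \<Longrightarrow> G i j = G j i"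
    and v: "orthonormal n k v" "k < n" "\<And>l. l < k \<Longrightarrow> eigen n H (c l) (v l)"
  obtains w where "ip n w w = 1" "\<And>l. l < k \<Longrightarrow> ip n (v l) w = 0"
    "eigen n H (rayleigh n H w) w"
    "\<And>x. ip n x x = 1 \<Longrightarrow> (\<And>l. l < k \<Longrightarrow> ip n (v l) x = 0) \<Longrightarrow> rayleigh n H x \<le> rayleigh n H w"
    "\<And>x. ip n x x = 1 \<Longrightarrow> (\<And>l. l < k \<Longrightarrow> ip n (v l) x = 0) \<Longrightarrow> ip n w x = 0 \<Longrightarrow>
      eigen n H (rayleigh n H w) x \<Longrightarrow>
      rayleigh n G x \<le> rayleigh n G w \<and> ip n x (apply_form n G w) = 0"
proof -
  define W where "W = {x. \<forall>l<k. ip n (v l) x = 0}"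
  define K where "K = {x. (\<forall>i\<ge>n. x i = 0) \<and> ip n x x = 1 \<and> (\<forall>l<k. ip n (v l) x = 0)}"
  \<comment> \<open>Truncation moves unit vectors of \<open>W\<close> into the compact set
    \<open>K\<close> without changing inner products or forms, so maximality over \<open>K\<close>
    extends to \<open>W\<close>.\<close>
  define trunc :: "(nat \<Rightarrow> real) \<Rightarrow> nat \<Rightarrow> real" where "trunc = (\<lambda>x i. if i < n then x i else 0)"
  have ip_trunc: "ip n x (trunc y) = ip n x y" "ip n (trunc x) y = ip n x y" for x y
    by (auto intro: ip_cong simp: trunc_def)
  have form_trunc: "apply_form n M (trunc x) = apply_form n M x" for M x
    by (rule apply_form_cong) (simp add: trunc_def)
  have ray_trunc: "rayleigh n M (trunc x) = rayleigh n M x" for M x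
    by (simp add: rayleigh_def form_trunc ip_trunc)
  have trunc_K: "trunc x \<in> K" if "x \<in> W" "ip n x x = 1" for x
    using that by (auto simp: K_def W_def ip_trunc) (auto simp: trunc_def)
  have W_add: "(\<lambda>i. x i + y i) \<in> W" if "x \<in> W" "y \<in> W" for x y
    using that by (auto simp: W_def ip_linear)
  have W_scale: "(\<lambda>i. a * x i) \<in> W" if "x \<in> W" for a x
    using that by (auto simp: W_def ip_linear)
  obtain x0 where "ip n x0 x0 = 1" "\<And>l. l < k \<Longrightarrow> ip n (v l) x0 = 0"
    using orthonormal_extend[OF v(1,2)] by blast
  then have "K \<noteq> {}"
    using trunc_K[of x0] by (auto simp: W_def)
  then obtain w where w: "w \<in> K" "\<And>x. x \<in> K \<Longrightarrow> rayleigh n H x \<le> rayleigh n H w"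
    "\<And>x. x \<in> K \<Longrightarrow> rayleigh n H x = rayleigh n H w \<Longrightarrow> rayleigh n G x \<le> rayleigh n G w"
    using compact_lexicographic_maximum[of K "rayleigh n H" "rayleigh n G"]
      compact_unit_sphere_of_complement[of n k v, folded K_def] continuous_on_rayleigh by metis
  have wW: "w \<in> W" "ip n w w = 1"
    using w(1) by (auto simp: K_def W_def)
  have maxH: "rayleigh n H x \<le> rayleigh n H w" if "x \<in> W" "ip n x x = 1" for x
    using w(2)[OF trunc_K[OF that]] by (simp add: ray_trunc)
  have statH: "ip n z (apply_form n H w) = rayleigh n H w * ip n z w" if "z \<in> W" for z
    unfolding rayleigh_def
    by (rule form_maximizer_stationary[of n H W])
      (use symH W_add W_scale maxH wW that in \<open>auto simp: rayleigh_def\<close>)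
  \<comment> \<open>The defect of the eigenvalue equation lies in \<open>W\<close>, since the
    \<open>v l\<close> are eigenvectors and \<open>H\<close> is symmetric. Testing stationarity
    against the defect itself shows that its length is zero.\<close>
  define z where "z = (\<lambda>i. apply_form n H w i - rayleigh n H w * w i)"
  have "z \<in> W"
    unfolding W_def
  proof (intro CollectI allI impI)
    fix l assume l: "l < k"
    have "ip n (v l) (apply_form n H w) = ip n w (apply_form n H (v l))"
      using ip_apply_form_commute[of n H "v l" w] symH by (simp add: ip_commute)
    also have "\<dots> = c l * ip n w (v l)"
      using eigen_ip[OF v(3)[OF l]] .
    finally show "ip n (v l) z = 0"
      using l wW(1) by (simp add: z_def ip_linear W_def ip_commute[of n w "v l"])
  qed
  then have "ip n z (apply_form n H w) = rayleigh n H w * ip n z w"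
    by (rule statH)
  then have "ip n z z = 0"
    by (subst (2) z_def) (simp add: ip_linear)
  then have eig: "eigen n H (rayleigh n H w) w"
    by (simp add: ip_self_eq_0 eigen_def z_def)
  have ray_eig: "rayleigh n H x = c" if "eigen n H c x" "ip n x x = 1" for x c
    using that by (simp add: rayleigh_def eigen_ip)
  define E where "E = {x \<in> W. eigen n H (rayleigh n H w) x}"
  \<comment> \<open>All unit vectors of \<open>E\<close> have the same \<open>H\<close>-value as
    \<open>w\<close>, so the tie-break by \<open>G\<close> applies to them.\<close>
  have maxG: "rayleigh n G x \<le> rayleigh n G w" if "x \<in> E" "ip n x x = 1" for x
    using w(3)[OF trunc_K[of x]] that ray_eig[of "rayleigh n H w" x] by (simp add: ray_trunc E_def)
  have statG: "ip n z (apply_form n G w) = rayleigh n G w * ip n z w" if "z \<in> E" for z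
    unfolding rayleigh_def
    by (rule form_maximizer_stationary[of n G E])
      (use symG W_add W_scale eigen_add eigen_scale maxG eig wW that in \<open>auto simp: rayleigh_def E_def\<close>)
  show ?thesis
  proof
    show "ip n w w = 1" "eigen n H (rayleigh n H w) w" by fact+
    show "ip n (v l) w = 0" if "l < k" for l
      using wW(1) that by (simp add: W_def)
    show "rayleigh n H x \<le> rayleigh n H w" if "ip n x x = 1" "\<And>l. l < k \<Longrightarrow> ip n (v l) x = 0" for x
      using maxH that by (simp add: W_def)
    show "rayleigh n G x \<le> rayleigh n G w \<and> ip n x (apply_form n G w) = 0"
      if "ip n x x = 1" "\<And>l. l < k \<Longrightarrow> ip n (v l) x = 0" "ip n w x = 0"
        "eigen n H (rayleigh n H w) x" for x
      using maxG[of x] statG[of x] that by (simp add: E_def W_def ip_commute[of n x w])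
  qed
qed

text \<open>A greedy choice by \<open>lexicographic_eigenvector_step\<close>. Equal eigenvalues put
  a later vector into the eigenspace of an earlier one, so the \<open>G\<close>-part of the step
  diagonalises \<open>G\<close> inside every eigenspace of \<open>H\<close>, with decreasing
  diagonal.\<close>

theorem lexicographic_spectral_basis:
  assumes symH: "\<And>i j. i < n \<Longrightarrow> j < n \<Longrightarrow> H i j = H j i"
    and symG: "\<And>i j. i < n \<Longrightarrow> j < n \<Longrightarrow> G i j = G j i"
  obtains v h where "orthonormal n n v" "\<And>l. l < n \<Longrightarrow> eigen n H (h l) (v l)"
    "\<And>i j. i \<le> j \<Longrightarrow> j < n \<Longrightarrow> h j \<le> h i"
    "\<And>i j. i < n \<Longrightarrow> j < n \<Longrightarrow> i \<noteq> j \<Longrightarrow> h i = h j \<Longrightarrow> ip n (v i) (apply_form n G (v j)) = 0"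
    "\<And>i j. i \<le> j \<Longrightarrow> j < n \<Longrightarrow> h i = h j \<Longrightarrow> rayleigh n G (v j) \<le> rayleigh n G (v i)"
proof -
  \<comment> \<open>The invariant compares \<open>v l\<close> only with vectors orthogonal to
    \<open>v 0\<close>, ..., \<open>v l\<close>. It thus mentions no later vector and survives the
    update at \<open>k\<close>.\<close>
  define Q where "Q = (\<lambda>v (l::nat). eigen n H (rayleigh n H (v l)) (v l) \<and>
    (\<forall>x. ip n x x = 1 \<longrightarrow> (\<forall>i\<le>l. ip n (v i) x = 0) \<longrightarrow> rayleigh n H x \<le> rayleigh n H (v l) \<and>
      (eigen n H (rayleigh n H (v l)) x \<longrightarrow>
        rayleigh n G x \<le> rayleigh n G (v l) \<and> ip n x (apply_form n G (v l)) = 0)))"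
  have "k \<le> n \<Longrightarrow> \<exists>v. orthonormal n k v \<and> (\<forall>l<k. Q v l)" for k
  proof (induction k)
    case 0
    then show ?case by (simp add: orthonormal_def)
  next
    case (Suc k)
    then obtain v where v: "orthonormal n k v" "\<forall>l<k. Q v l" by auto
    obtain w where w: "ip n w w = 1" "\<And>l. l < k \<Longrightarrow> ip n (v l) w = 0"
      "eigen n H (rayleigh n H w) w"
      "\<And>x. ip n x x = 1 \<Longrightarrow> (\<And>l. l < k \<Longrightarrow> ip n (v l) x = 0) \<Longrightarrow> rayleigh n H x \<le> rayleigh n H w"
      "\<And>x. ip n x x = 1 \<Longrightarrow> (\<And>l. l < k \<Longrightarrow> ip n (v l) x = 0) \<Longrightarrow> ip n w x = 0 \<Longrightarrow>
        eigen n H (rayleigh n H w) x \<Longrightarrow>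
        rayleigh n G x \<le> rayleigh n G w \<and> ip n x (apply_form n G w) = 0"
      by (rule lexicographic_eigenvector_step[where n = n and H = H and G = G and k = k and v = v
            and c = "\<lambda>l. rayleigh n H (v l)"])
        (use symH symG v Suc.prems in \<open>auto simp: Q_def\<close>)
    have "orthonormal n (Suc k) (v(k := w))"
      by (rule orthonormal_fun_upd[OF v(1) w(1,2)])
    moreover have "Q (v(k := w)) l" if "l < Suc k" for l
    proof (cases "l = k")
      case True
      have perp: "(\<forall>i<k. ip n (v i) x = 0) \<and> ip n w x = 0" if "\<forall>i\<le>k. ip n ((v(k := w)) i) x = 0" for x
        using that by (auto simp: le_less split: if_splits)
      show ?thesis
        unfolding Q_def True fun_upd_same
      proof (intro conjI allI impI)
        fix x
        assume x: "ip n x x = 1" "\<forall>i\<le>k. ip n ((v(k := w)) i) x = 0"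
        note w' = perp[OF x(2), THEN conjunct1, rule_format] perp[OF x(2), THEN conjunct2]
        show "rayleigh n H x \<le> rayleigh n H w"
          using w(4)[OF x(1) w'(1)] .
        assume "eigen n H (rayleigh n H w) x"
        from w(5)[OF x(1) w' this]
        show "rayleigh n G x \<le> rayleigh n G w" "ip n x (apply_form n G w) = 0" by auto
      qed (fact w(3))
    next
      case False
      then have "l < k" using that by simp
      then have "(\<forall>i\<le>l. ip n ((v(k := w)) i) x = 0) = (\<forall>i\<le>l. ip n (v i) x = 0)" for x
        by auto
      moreover have "(v(k := w)) l = v l" using False by simp
      ultimately show ?thesis
        using v(2) \<open>l < k\<close> unfolding Q_def by metis
    qed
    ultimately show ?case by blast
  qed
  then obtain v where v: "orthonormal n n v" "\<And>l. l < n \<Longrightarrow> Q v l" by blast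
  have later: "ip n (v j) (v j) = 1" "\<forall>l\<le>i. ip n (v l) (v j) = 0" if "i < j" "j < n" for i j
    using v(1) that by (auto simp: orthonormal_def)
  have tie: "eigen n H (rayleigh n H (v i)) (v j)" if "rayleigh n H (v i) = rayleigh n H (v j)" "j < n" for i j
    using v(2)[of j] that by (simp add: Q_def)
  have orthG: "ip n (v j) (apply_form n G (v i)) = 0"
    if "i < j" "j < n" "rayleigh n H (v i) = rayleigh n H (v j)" for i j
    using v(2)[of i] that later[OF that(1,2)] tie[OF that(3,2)] by (simp add: Q_def)
  show ?thesis
  proof (rule that[of v "\<lambda>l. rayleigh n H (v l)"])
    show "orthonormal n n v" by fact
    show "eigen n H (rayleigh n H (v l)) (v l)" if "l < n" for l
      using v(2)[OF that] by (simp add: Q_def)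
    show "rayleigh n H (v j) \<le> rayleigh n H (v i)" if "i \<le> j" "j < n" for i j
      using v(2)[of i] that later[of i j] by (cases "i = j") (auto simp: Q_def)
    show "rayleigh n G (v j) \<le> rayleigh n G (v i)"
      if "i \<le> j" "j < n" "rayleigh n H (v i) = rayleigh n H (v j)" for i j
      using v(2)[of i] that later[of i j] tie[of i j] by (cases "i = j") (auto simp: Q_def)
    show "ip n (v i) (apply_form n G (v j)) = 0"
      if "i < n" "j < n" "i \<noteq> j" "rayleigh n H (v i) = rayleigh n H (v j)" for i j
    proof (cases "i < j")
      case True
      then show ?thesis
        using orthG[OF True that(2,4)] ip_apply_form_commute[of n G "v i" "v j"] symG
        by (simp add: ip_commute)
    next
      case False
      then show ?thesis
        using orthG[of j i] that by simp
    qed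
  qed
qed

section \<open>Adapted singular bases\<close>

lemma ip_gram:
  "ip m (apply_form n a x) (apply_form n b y) = ip n x (apply_form n (\<lambda>i j. \<Sum>k<m. a k i * b k j) y)"
proof -
  have "ip m (apply_form n a x) (apply_form n b y)
      = (\<Sum>k<m. \<Sum>i<n. \<Sum>j<n. a k i * x i * (b k j * y j))"
    by (simp add: ip_def apply_form_def sum_product)
  also have "\<dots> = (\<Sum>i<n. \<Sum>k<m. \<Sum>j<n. a k i * x i * (b k j * y j))"
    by (rule sum.swap)
  also have "\<dots> = (\<Sum>i<n. \<Sum>j<n. \<Sum>k<m. a k i * x i * (b k j * y j))"
    by (intro sum.cong refl sum.swap)
  also have "\<dots> = ip n x (apply_form n (\<lambda>i j. \<Sum>k<m. a k i * b k j) y)"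
    by (simp add: ip_def apply_form_def sum_distrib_left sum_distrib_right ac_simps)
  finally show ?thesis .
qed

lemma apply_form_sum_forms:
  "apply_form n (\<lambda>i j. a i j + b i j) x = (\<lambda>i. apply_form n a x i + apply_form n b x i)"
  by (auto simp: apply_form_def algebra_simps sum.distrib)

text \<open>The \<open>v l\<close> come from the spectral basis for \<open>A^T A\<close> and
  \<open>A^T E + E^T A\<close>, and \<open>u l = A v l / d l\<close> where \<open>d l > 0\<close>.
  For equal singular values, the second form evaluates to \<open>d i\<close> times the symmetrised
  entries of \<open>U^T E V\<close>, which turns the properties of \<open>G\<close> into the last
  two claims.\<close>

lemma adapted_singular_bases:
  fixes a e :: "nat \<Rightarrow> nat \<Rightarrow> real"
  obtains u v d r where "orthonormal m m u" "orthonormal n n v" "r \<le> m" "r \<le> n"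
    "\<And>l. l < r \<Longrightarrow> d l > (0::real)"
    "\<And>l i. l < r \<Longrightarrow> i < m \<Longrightarrow> apply_form n a (v l) i = d l * u l i"
    "\<And>l i. r \<le> l \<Longrightarrow> l < n \<Longrightarrow> i < m \<Longrightarrow> apply_form n a (v l) i = 0"
    "\<And>i j. i \<le> j \<Longrightarrow> j < r \<Longrightarrow> d j \<le> d i"
    "\<And>i j. i < r \<Longrightarrow> j < r \<Longrightarrow> i \<noteq> j \<Longrightarrow> d i = d j \<Longrightarrow>
      ip m (u i) (apply_form n e (v j)) + ip m (u j) (apply_form n e (v i)) = 0"
    "\<And>i j. i \<le> j \<Longrightarrow> j < r \<Longrightarrow> d i = d j \<Longrightarrow>
      ip m (u j) (apply_form n e (v j)) \<le> ip m (u i) (apply_form n e (v i))"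
proof -
  define H where "H = (\<lambda>i j. \<Sum>k<m. a k i * a k j)"
  \<comment> \<open>\<open>H + G eps\<close> is the Gram matrix of \<open>A + E eps\<close>.\<close>
  define G where "G = (\<lambda>i j. (\<Sum>k<m. a k i * e k j) + (\<Sum>k<m. e k i * a k j))"
  obtain v h where v: "orthonormal n n v" "\<And>l. l < n \<Longrightarrow> eigen n H (h l) (v l)"
    and h_mono: "\<And>i j. i \<le> j \<Longrightarrow> j < n \<Longrightarrow> h j \<le> h i"
    and G0: "\<And>i j. i < n \<Longrightarrow> j < n \<Longrightarrow> i \<noteq> j \<Longrightarrow> h i = h j \<Longrightarrow> ip n (v i) (apply_form n G (v j)) = 0"
    and G_mono: "\<And>i j. i \<le> j \<Longrightarrow> j < n \<Longrightarrow> h i = h j \<Longrightarrow> rayleigh n G (v j) \<le> rayleigh n G (v i)"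
    by (rule lexicographic_spectral_basis[of n H G]) (auto simp: H_def G_def mult.commute)
  define av where "av = (\<lambda>l. apply_form n a (v l))"
  define ev where "ev = (\<lambda>l. apply_form n e (v l))"
  have av_ip: "ip m (av i) (av j) = (if i = j then h i else 0)" if "i < n" "j < n" for i j
    using eigen_ip[OF v(2)[OF that(2)], of "v i"] v(1) that
    by (simp add: av_def ip_gram H_def orthonormal_def)
  have G_ip: "ip n (v i) (apply_form n G (v j)) = ip m (av i) (ev j) + ip m (ev i) (av j)" for i j
    by (simp add: av_def ev_def ip_gram G_def apply_form_sum_forms ip_linear)
  have h_nonneg: "h l \<ge> 0" if "l < n" for l
    using av_ip[OF that that] ip_self_nonneg[of m "av l"] by simp
  \<comment> \<open>\<open>h l\<close> is the squared length of the image of \<open>v l\<close>, and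
    \<open>r\<close> counts the positive ones. The alternative \<open>l = n\<close> provides a least
    element when all are positive.\<close>
  define r where "r = (LEAST l. l = n \<or> h l \<le> 0)"
  have "r = n \<or> h r \<le> 0"
    unfolding r_def by (rule LeastI[of _ n]) simp
  moreover have rn: "r \<le> n"
    unfolding r_def by (rule Least_le) simp
  ultimately have h_zero: "h l = 0" if "r \<le> l" "l < n" for l
    using h_mono[of r l] h_nonneg[of l] that by force
  have h_pos: "h l > 0" if "l < r" for l
    using not_less_Least[of l "\<lambda>l. l = n \<or> h l \<le> 0"] that unfolding r_def by auto
  define d where "d = (\<lambda>l. sqrt (h l))"
  have d_pos: "d l > 0" if "l < r" for l
    using h_pos[OF that] by (simp add: d_def)
  have on: "orthonormal m r (\<lambda>l i. inverse (d l) * av l i)"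
    unfolding orthonormal_def ip_linear
  proof (intro allI impI)
    fix i j assume ij: "i < r" "j < r"
    have "inverse (d j) * (inverse (d j) * h j) = 1"
      using h_pos[OF ij(2)] by (simp add: d_def field_simps)
    then show "inverse (d j) * (inverse (d i) * ip m (av i) (av j)) = (if i = j then 1 else 0)"
      using av_ip[of i j] ij rn by auto
  qed
  have rm: "r \<le> m"
    by (rule orthonormal_card_le[OF on])
  obtain u where u: "orthonormal m m u" "\<And>l. l < r \<Longrightarrow> u l = (\<lambda>i. inverse (d l) * av l i)"
    using orthonormal_complete[OF on] by blast
  have av_u: "av l = (\<lambda>i. d l * u l i)" if "l < r" for l
    using u(2)[OF that] d_pos[OF that] by (auto simp: fun_eq_iff)
  have G_C: "ip n (v i) (apply_form n G (v j)) = d i * (ip m (u i) (ev j) + ip m (u j) (ev i))"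
    if "i < r" "j < r" "d i = d j" for i j
    using that by (simp add: G_ip av_u ip_linear ip_commute[of m "ev i"] algebra_simps)
  have d_tie: "h i = h j" if "d i = d j" for i j
    using that by (simp add: d_def)
  show ?thesis
  proof (rule that[of u v r d])
    show "orthonormal m m u" "orthonormal n n v" "r \<le> m" "r \<le> n" by fact+
    show "d l > 0" if "l < r" for l by (rule d_pos[OF that])
    show "apply_form n a (v l) i = d l * u l i" if "l < r" "i < m" for l i
      using av_u[OF that(1)] by (simp add: av_def)
    show "apply_form n a (v l) i = 0" if "r \<le> l" "l < n" "i < m" for l i
      using av_ip[of l l] h_zero that by (simp add: av_def ip_self_eq_0)
    show "d j \<le> d i" if "i \<le> j" "j < r" for i j
      using h_mono[of i j] that rn by (simp add: d_def)
    show "ip m (u i) (apply_form n e (v j)) + ip m (u j) (apply_form n e (v i)) = 0"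
      if "i < r" "j < r" "i \<noteq> j" "d i = d j" for i j
      using G_C[OF that(1,2,4)] G0[of i j] d_tie[OF that(4)] that(1-3) d_pos[OF that(1)] rn
      by (simp add: ev_def)
    show "ip m (u j) (apply_form n e (v j)) \<le> ip m (u i) (apply_form n e (v i))"
      if "i \<le> j" "j < r" "d i = d j" for i j
      using G_C[of i i] G_C[of j j] G_mono[of i j] d_tie[OF that(3)] that d_pos[of j] rn
      by (simp add: ev_def rayleigh_def)
  qed
qed

section \<open>Rectangular diagonal matrices and the real singular value decomposition\<close>

definition rdiag :: "nat \<Rightarrow> nat \<Rightarrow> nat \<Rightarrow> (nat \<Rightarrow> real) \<Rightarrow> real mat" where
  "rdiag m n r f = mat m n (\<lambda>(i, j). if i = j \<and> i < r then f i else 0)"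

lemma rdiag_carrier [simp]: "rdiag m n r f \<in> carrier_mat m n"
  by (simp add: rdiag_def)

lemma transpose_rdiag: "transpose_mat (rdiag m n r f) = rdiag n m r f"
  by (rule eq_matI) (auto simp: rdiag_def)

lemma rdiag_mult_index:
  assumes "M \<in> carrier_mat n p" "r \<le> n" "i < m" "j < p"
  shows "(rdiag m n r f * M) $$ (i, j) = (if i < r then f i * M $$ (i, j) else 0)"
proof -
  have "(rdiag m n r f * M) $$ (i, j) = (\<Sum>k = 0..<n. rdiag m n r f $$ (i, k) * M $$ (k, j))"
    using assms by (simp add: scalar_prod_def rdiag_def)
  also have "\<dots> = (\<Sum>k = 0..<n. if k = i then (if i < r then f i * M $$ (i, j) else 0) else 0)"
    using assms by (intro sum.cong) (auto simp: rdiag_def)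
  finally show ?thesis using assms by simp
qed

lemma mult_rdiag_index:
  assumes "M \<in> carrier_mat p m" "r \<le> m" "i < p" "j < n"
  shows "(M * rdiag m n r f) $$ (i, j) = (if j < r then M $$ (i, j) * f j else 0)"
proof -
  have "(M * rdiag m n r f) $$ (i, j) = (\<Sum>k = 0..<m. M $$ (i, k) * rdiag m n r f $$ (k, j))"
    using assms by (simp add: scalar_prod_def rdiag_def)
  also have "\<dots> = (\<Sum>k = 0..<m. if k = j then (if j < r then M $$ (i, j) * f j else 0) else 0)"
    using assms by (intro sum.cong) (auto simp: rdiag_def)
  finally show ?thesis using assms by simp
qed

lemma rdiag_mult:
  assumes "r \<le> n"
  shows "rdiag m n r f * rdiag n p r g = rdiag m p r (\<lambda>i. f i * g i)"
proof (rule eq_matI)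
  fix i j
  assume "i < dim_row (rdiag m p r (\<lambda>i. f i * g i))" "j < dim_col (rdiag m p r (\<lambda>i. f i * g i))"
  then have "i < m" "j < p" by (simp_all add: rdiag_def)
  then show "(rdiag m n r f * rdiag n p r g) $$ (i, j) = rdiag m p r (\<lambda>i. f i * g i) $$ (i, j)"
    unfolding rdiag_mult_index[OF rdiag_carrier assms \<open>i < m\<close> \<open>j < p\<close>]
    using assms by (auto simp: rdiag_def)
qed (auto simp: rdiag_def)

text \<open>The bridge from vectors as functions to matrices whose columns are these
  vectors.\<close>

lemma index_transpose_mult_mult:
  assumes "M \<in> carrier_mat m n" "i < p" "j < q"
  shows "(transpose_mat (mat m p (\<lambda>(i, j). u j i)) * M * mat n q (\<lambda>(i, j). v j i)) $$ (i, j)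
    = ip m (u i) (apply_form n (\<lambda>i j. M $$ (i, j)) (v j))"
proof -
  have "transpose_mat (mat m p (\<lambda>(i, j). u j i)) * M * mat n q (\<lambda>(i, j). v j i)
      = transpose_mat (mat m p (\<lambda>(i, j). u j i)) * (M * mat n q (\<lambda>(i, j). v j i))"
    using assms(1) by (intro assoc_mult_mat[of _ p m _ n _ q]) auto
  then show ?thesis
    using assms by (auto simp: ip_def apply_form_def scalar_prod_def atLeast0LessThan intro!: sum.cong)
qed

lemma orthonormal_mat:
  assumes "orthonormal n n u"
  defines "U \<equiv> mat n n (\<lambda>(i, j). u j i)"
  shows "transpose_mat U * U = 1\<^sub>m n" "U * transpose_mat U = 1\<^sub>m n"
proof -
  show *: "transpose_mat U * U = 1\<^sub>m n"
    by (rule eq_matI)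
      (use assms(1) in \<open>auto simp: U_def scalar_prod_def orthonormal_def ip_def atLeast0LessThan\<close>)
  show "U * transpose_mat U = 1\<^sub>m n"
    by (rule mat_mult_left_right_inverse[OF _ _ *]) (auto simp: U_def)
qed

text \<open>\<open>adapted_singular_bases\<close> in matrix form. With \<open>E = A\<close> it
  supplies an ordinary singular value decomposition; the last two clauses prepare the dual
  one.\<close>

lemma adapted_svd:
  fixes A E :: "real mat"
  assumes A: "A \<in> carrier_mat m n" and E: "E \<in> carrier_mat m n"
  obtains U V d r where "U \<in> carrier_mat m m" "V \<in> carrier_mat n n"
    "transpose_mat U * U = 1\<^sub>m m" "U * transpose_mat U = 1\<^sub>m m"
    "transpose_mat V * V = 1\<^sub>m n" "V * transpose_mat V = 1\<^sub>m n"
    "r \<le> m" "r \<le> n" "transpose_mat U * A * V = rdiag m n r d"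
    "\<And>l. l < r \<Longrightarrow> d l > 0" "\<And>i j. i \<le> j \<Longrightarrow> j < r \<Longrightarrow> d j \<le> d i"
    "\<And>i j. i < r \<Longrightarrow> j < r \<Longrightarrow> i \<noteq> j \<Longrightarrow> d i = d j \<Longrightarrow>
      (transpose_mat U * E * V) $$ (i, j) + (transpose_mat U * E * V) $$ (j, i) = 0"
    "\<And>i j. i \<le> j \<Longrightarrow> j < r \<Longrightarrow> d i = d j \<Longrightarrow>
      (transpose_mat U * E * V) $$ (j, j) \<le> (transpose_mat U * E * V) $$ (i, i)"
proof -
  obtain u v d r where uv: "orthonormal m m u" "orthonormal n n v" and r: "r \<le> m" "r \<le> n"
    and d: "\<And>l. l < r \<Longrightarrow> d l > (0::real)"
    and Au: "\<And>l i. l < r \<Longrightarrow> i < m \<Longrightarrow> apply_form n (\<lambda>i j. A $$ (i, j)) (v l) i = d l * u l i"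
    and A0: "\<And>l i. r \<le> l \<Longrightarrow> l < n \<Longrightarrow> i < m \<Longrightarrow> apply_form n (\<lambda>i j. A $$ (i, j)) (v l) i = 0"
    and d_mono: "\<And>i j. i \<le> j \<Longrightarrow> j < r \<Longrightarrow> d j \<le> d i"
    and C0: "\<And>i j. i < r \<Longrightarrow> j < r \<Longrightarrow> i \<noteq> j \<Longrightarrow> d i = d j \<Longrightarrow>
      ip m (u i) (apply_form n (\<lambda>i j. E $$ (i, j)) (v j)) + ip m (u j) (apply_form n (\<lambda>i j. E $$ (i, j)) (v i)) = 0"
    and C_mono: "\<And>i j. i \<le> j \<Longrightarrow> j < r \<Longrightarrow> d i = d j \<Longrightarrow>
      ip m (u j) (apply_form n (\<lambda>i j. E $$ (i, j)) (v j)) \<le> ip m (u i) (apply_form n (\<lambda>i j. E $$ (i, j)) (v i))"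
    by (rule adapted_singular_bases[of m n "\<lambda>i j. A $$ (i, j)" "\<lambda>i j. E $$ (i, j)"]) blast
  define U where "U = mat m m (\<lambda>(i, j). u j i)"
  define V where "V = mat n n (\<lambda>(i, j). v j i)"
  have A_index: "(transpose_mat U * A * V) $$ (i, j) = (if i = j \<and> i < r then d i else 0)"
    if "i < m" "j < n" for i j
  proof (cases "j < r")
    case True
    then have "(transpose_mat U * A * V) $$ (i, j) = ip m (u i) (\<lambda>k. d j * u j k)"
      unfolding U_def V_def index_transpose_mult_mult[OF A that] by (intro ip_cong Au refl)
    then show ?thesis
      using uv(1) that True r by (auto simp: ip_linear orthonormal_def)
  next
    case False
    then have "(transpose_mat U * A * V) $$ (i, j) = ip m (u i) (\<lambda>k. 0)"
      unfolding U_def V_def index_transpose_mult_mult[OF A that] using that by (intro ip_cong A0 refl) auto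
    then show ?thesis
      using False by (simp add: ip_def)
  qed
  have E_index: "(transpose_mat U * E * V) $$ (i, j) = ip m (u i) (apply_form n (\<lambda>i j. E $$ (i, j)) (v j))"
    if "i < m" "j < n" for i j
    unfolding U_def V_def index_transpose_mult_mult[OF E that] ..
  show ?thesis
  proof (rule that[of U V r d])
    show "U \<in> carrier_mat m m" "V \<in> carrier_mat n n" by (auto simp: U_def V_def)
    show "transpose_mat U * U = 1\<^sub>m m" "U * transpose_mat U = 1\<^sub>m m"
      "transpose_mat V * V = 1\<^sub>m n" "V * transpose_mat V = 1\<^sub>m n"
      unfolding U_def V_def using orthonormal_mat uv by blast+
    show "transpose_mat U * A * V = rdiag m n r d"
      by (rule eq_matI) (use A_index in \<open>auto simp: rdiag_def U_def V_def simp del: index_mult_mat(1)\<close>)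
    show "(transpose_mat U * E * V) $$ (i, j) + (transpose_mat U * E * V) $$ (j, i) = 0"
      if "i < r" "j < r" "i \<noteq> j" "d i = d j" for i j
      using C0[OF that] E_index[of i j] E_index[of j i] that(1,2) r by linarith
    show "(transpose_mat U * E * V) $$ (j, j) \<le> (transpose_mat U * E * V) $$ (i, i)"
      if "i \<le> j" "j < r" "d i = d j" for i j
      using C_mono[OF that] E_index[of i i] E_index[of j j] that(1,2) r by linarith
  qed (use r d d_mono in auto)
qed

section \<open>The algebra of dual matrices and Moore-Penrose inverses\<close>

text \<open>Dimension equations as side conditions, unlike carrier memberships, contain no extra variables,
  so the simplifier can discharge them.\<close>

lemma mult_assoc_dim:
  "dim_col A = dim_row B \<Longrightarrow> dim_col B = dim_row C \<Longrightarrow> A * B * C = A * (B * (C :: real mat))"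
  by (rule assoc_mult_mat[of _ "dim_row A" "dim_col A" _ "dim_col B" _ "dim_col C"]) auto

lemma mult_add_dim:
  "dim_col A = dim_row B \<Longrightarrow> dim_row B = dim_row C \<Longrightarrow> dim_col B = dim_col C \<Longrightarrow>
    A * (B + C) = A * B + A * (C :: real mat)"
  by (rule mult_add_distrib_mat[of _ "dim_row A" "dim_col A" _ "dim_col B"]) auto

lemma add_mult_dim:
  "dim_col A = dim_row C \<Longrightarrow> dim_row A = dim_row B \<Longrightarrow> dim_col A = dim_col B \<Longrightarrow>
    (A + B) * C = A * C + B * (C :: real mat)"
  by (rule add_mult_distrib_mat[of _ "dim_row A" "dim_col A" _ _ "dim_col C"]) auto

lemma transpose_mult_dim:
  "dim_col A = dim_row B \<Longrightarrow> transpose_mat (A * B) = transpose_mat B * transpose_mat (A :: real mat)"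
  by (rule transpose_mult[of _ "dim_row A" "dim_col A" _ "dim_col B"]) auto

lemma transpose_add_dim:
  "dim_row A = dim_row B \<Longrightarrow> dim_col A = dim_col B \<Longrightarrow>
    transpose_mat (A + B) = transpose_mat A + transpose_mat (B :: real mat)"
  by (rule transpose_add[of _ "dim_row A" "dim_col A"]) auto

lemma add_assoc_dim:
  "dim_row A = dim_row B \<Longrightarrow> dim_col A = dim_col B \<Longrightarrow> dim_row B = dim_row C \<Longrightarrow> dim_col B = dim_col C \<Longrightarrow>
    A + B + C = A + (B + (C :: real mat))"
  by (rule assoc_add_mat[of _ "dim_row A" "dim_col A"]) auto

lemma add_comm_dim:
  "dim_row A = dim_row B \<Longrightarrow> dim_col A = dim_col B \<Longrightarrow> A + B = B + (A :: real mat)"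
  by (rule comm_add_mat[of _ "dim_row A" "dim_col A"]) auto

lemma unit_mult_dim:
  "dim_row A = n \<Longrightarrow> 1\<^sub>m n * A = (A :: real mat)"
  "dim_col A = n \<Longrightarrow> A * 1\<^sub>m n = A"
  by auto

lemma zero_mult_dim:
  "dim_row A = n \<Longrightarrow> 0\<^sub>m k n * A = (0\<^sub>m k (dim_col A) :: real mat)"
  "dim_col A = n \<Longrightarrow> A * 0\<^sub>m n k = 0\<^sub>m (dim_row A) k"
  by (auto intro!: eq_matI)

lemma zero_add_dim:
  "dim_row A = m \<Longrightarrow> dim_col A = n \<Longrightarrow> 0\<^sub>m m n + A = (A :: real mat)"
  "dim_row A = m \<Longrightarrow> dim_col A = n \<Longrightarrow> A + 0\<^sub>m m n = A"
  by (auto intro!: eq_matI)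

lemma uminus_add_dim:
  "dim_row A = m \<Longrightarrow> dim_col A = n \<Longrightarrow> - A + A = (0\<^sub>m m n :: real mat)"
  "dim_row A = m \<Longrightarrow> dim_col A = n \<Longrightarrow> A + - A = (0\<^sub>m m n :: real mat)"
  by (auto intro!: eq_matI)

lemmas mat_dim_simps = mult_assoc_dim mult_add_dim add_mult_dim transpose_mult_dim transpose_add_dim
  unit_mult_dim zero_mult_dim zero_add_dim uminus_add_dim transpose_uminus

lemma dcarrierD:
  assumes "A \<in> dcarrier m n"
  shows "dim_row (fst A) = m" "dim_col (fst A) = n" "dim_row (snd A) = m" "dim_col (snd A) = n"
  using assms by (auto simp: dcarrier_def)

lemma dcarrierI:
  "dim_row (fst A) = m \<Longrightarrow> dim_col (fst A) = n \<Longrightarrow> dim_row (snd A) = m \<Longrightarrow> dim_col (snd A) = n \<Longrightarrow>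
    A \<in> dcarrier m n"
  by (auto simp: dcarrier_def)

lemma dmult_carrier: "A \<in> dcarrier m n \<Longrightarrow> B \<in> dcarrier n p \<Longrightarrow> dmult A B \<in> dcarrier m p"
  by (auto simp: dcarrier_def dmult_def)

lemma dtrans_carrier: "A \<in> dcarrier m n \<Longrightarrow> dtrans A \<in> dcarrier n m"
  by (auto simp: dcarrier_def dtrans_def)

lemma dmult_assoc:
  assumes "A \<in> dcarrier m n" "B \<in> dcarrier n p" "C \<in> dcarrier p q"
  shows "dmult (dmult A B) C = dmult A (dmult B C)"
  using assms[THEN dcarrierD(1)] assms[THEN dcarrierD(2)] assms[THEN dcarrierD(3)] assms[THEN dcarrierD(4)]
  by (simp add: dmult_def mat_dim_simps add_assoc_dim)

lemma dtrans_dmult: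
  assumes "A \<in> dcarrier m n" "B \<in> dcarrier n p"
  shows "dtrans (dmult A B) = dmult (dtrans B) (dtrans A)"
  using assms[THEN dcarrierD(1)] assms[THEN dcarrierD(2)] assms[THEN dcarrierD(3)] assms[THEN dcarrierD(4)]
  by (simp add: dmult_def dtrans_def mat_dim_simps add_comm_dim)

lemma dmult_did:
  assumes "A \<in> dcarrier m n"
  shows "dmult (did m) A = A" "dmult A (did n) = A"
  using dcarrierD[OF assms] by (simp_all add: dmult_def did_def mat_dim_simps)

text \<open>Penrose's argument uses only associativity and the transpose of products, which hold for
  dual matrices. It shows \<open>BX = BY\<close> and \<open>XB = YB\<close>, whence
  \<open>X = XBX = XBY = YBY = Y\<close>.\<close>

lemma is_dmpgi_unique:
  assumes "is_dmpgi B X" "is_dmpgi B Y" "B \<in> dcarrier m n"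
  shows "X = Y"
proof -
  have B: "B \<in> dcarrier m n" by fact
  have X: "X \<in> dcarrier n m" and Y: "Y \<in> dcarrier n m"
    using assms(1,2) dcarrierD[OF B] by (auto simp: is_dmpgi_def)
  note BX = dmult_carrier[OF B X] and BY = dmult_carrier[OF B Y]
    and XB = dmult_carrier[OF X B] and YB = dmult_carrier[OF Y B]
  have eqs: "dmult (dmult B X) B = B" "dmult (dmult X B) X = X"
    "dtrans (dmult B X) = dmult B X" "dtrans (dmult X B) = dmult X B"
    "dmult (dmult B Y) B = B" "dmult (dmult Y B) Y = Y"
    "dtrans (dmult B Y) = dmult B Y" "dtrans (dmult Y B) = dmult Y B"
    using assms by (auto simp: is_dmpgi_def)
  have "dmult B X = dmult (dmult B Y) (dmult B X)"
    using eqs(5) dmult_assoc[OF BY B X] by simp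
  \<comment> \<open>Transposing a product of two symmetric factors reverses their order.\<close>
  then have "dmult B X = dmult (dmult B X) (dmult B Y)"
    using dtrans_dmult[OF BY BX] eqs(3,7) by metis
  then have BXY: "dmult B X = dmult B Y"
    using eqs(1) dmult_assoc[OF BX B Y] by simp
  have "dmult Y B = dmult (dmult Y B) (dmult X B)"
    using eqs(1) dmult_assoc[OF Y B XB] dmult_assoc[OF B X B] by simp
  then have "dmult Y B = dmult (dmult X B) (dmult Y B)"
    using dtrans_dmult[OF YB XB] eqs(4,8) by metis
  then have XYB: "dmult Y B = dmult X B"
    using eqs(5) dmult_assoc[OF X B YB] dmult_assoc[OF B Y B] by simp
  have "X = dmult X (dmult B Y)"
    using eqs(2) dmult_assoc[OF X B X] BXY by simp
  also have "\<dots> = Y"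
    using eqs(6) dmult_assoc[OF X B Y] XYB by simp
  finally show ?thesis .
qed

section \<open>Existence and uniqueness of real Moore-Penrose inverses\<close>

definition is_mp :: "real mat \<Rightarrow> real mat \<Rightarrow> bool" where
  "is_mp A X \<longleftrightarrow> X \<in> carrier_mat (dim_col A) (dim_row A) \<and>
      A * X * A = A \<and> X * A * X = X \<and>
      transpose_mat (A * X) = A * X \<and> transpose_mat (X * A) = X * A"

lemma dmult_dreal: "dim_col A = dim_row B \<Longrightarrow> dmult (dreal A) (dreal B) = dreal (A * B)"
  by (simp add: dmult_def dreal_def mat_dim_simps)

lemma dtrans_dreal: "dtrans (dreal A) = dreal (transpose_mat A)"
  by (auto simp: dtrans_def dreal_def intro!: eq_matI)

lemma is_mp_imp_is_dmpgi: "is_mp A X \<Longrightarrow> is_dmpgi (dreal A) (dreal X)"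
  unfolding is_dmpgi_def is_mp_def
  by (auto simp: dmult_dreal dtrans_dreal intro!: dcarrierI) (simp_all add: dreal_def)

text \<open>Real uniqueness is inherited from the dual case through the embedding
  \<open>dreal\<close>.\<close>

lemma is_mp_unique:
  assumes "is_mp A X" "is_mp A Y"
  shows "X = Y"
proof -
  have "dreal X = dreal Y"
    by (rule is_dmpgi_unique[OF assms[THEN is_mp_imp_is_dmpgi], of "dim_row A" "dim_col A"])
      (simp add: dcarrier_def dreal_def)
  then show ?thesis by (simp add: dreal_def)
qed

text \<open>From \<open>A = U S V^T\<close> the inverse is \<open>V T U^T\<close>, where
  \<open>T\<close> inverts the nonzero diagonal entries of \<open>S\<close>.\<close>

lemma is_mp_exists: "\<exists>X. is_mp A X"
proof -
  define m n where "m = dim_row A" and "n = dim_col A"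
  have A: "A \<in> carrier_mat m n" by (auto simp: m_def n_def)
  obtain U V d r where UV: "U \<in> carrier_mat m m" "V \<in> carrier_mat n n"
    "transpose_mat U * U = 1\<^sub>m m" "U * transpose_mat U = 1\<^sub>m m"
    "transpose_mat V * V = 1\<^sub>m n" "V * transpose_mat V = 1\<^sub>m n"
    and r: "r \<le> m" "r \<le> n" and S: "transpose_mat U * A * V = rdiag m n r d"
    and d: "\<And>l. l < r \<Longrightarrow> d l > 0"
    by (rule adapted_svd[OF A A]) blast
  define S where "S = rdiag m n r d"
  define T where "T = rdiag n m r (\<lambda>i. 1 / d i)"
  have dims: "dim_row U = m" "dim_col U = m" "dim_row V = n" "dim_col V = n"
    "dim_row S = m" "dim_col S = n" "dim_row T = n" "dim_col T = m"
    using UV by (auto simp: S_def T_def rdiag_def)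
  have cancel: "transpose_mat U * (U * M) = M" "U * (transpose_mat U * M) = M" if "dim_row M = m" for M
    using UV(3,4) that dims by (simp_all add: mult_assoc_dim[symmetric] unit_mult_dim del: assoc_mult_mat)
  have cancelV: "transpose_mat V * (V * M) = M" "V * (transpose_mat V * M) = M" if "dim_row M = n" for M
    using UV(5,6) that dims by (simp_all add: mult_assoc_dim[symmetric] unit_mult_dim del: assoc_mult_mat)
  have A_eq: "A = U * (S * transpose_mat V)"
  proof -
    have "U * (S * transpose_mat V) = U * (transpose_mat U * A * V * transpose_mat V)"
      using S by (simp add: S_def)
    also have "\<dots> = A"
      using A UV(6) dims by (simp add: mat_dim_simps cancel)
    finally show ?thesis by simp
  qed
  have ST: "S * T = rdiag m m r (\<lambda>i. 1)" "T * S = rdiag n n r (\<lambda>i. 1)"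
    unfolding S_def T_def using r d[THEN less_imp_neq, symmetric]
    by (auto simp: rdiag_mult) (auto simp: rdiag_def intro!: eq_matI)
  have STS: "S * (T * S) = S" "T * (S * T) = T"
    unfolding ST unfolding S_def T_def using r by (simp_all add: rdiag_mult)
  have sym: "transpose_mat (S * T) = S * T" "transpose_mat (T * S) = T * S"
    unfolding ST transpose_rdiag by simp_all
  define X where "X = V * (T * transpose_mat U)"
  have AX: "A * X = U * (S * T * transpose_mat U)" and XA: "X * A = V * (T * S * transpose_mat V)"
    unfolding A_eq X_def using dims by (simp_all add: mult_assoc_dim cancel cancelV)
  have "is_mp A X"
    unfolding is_mp_def
  proof (intro conjI)
    show "X \<in> carrier_mat (dim_col A) (dim_row A)"
      by (rule carrier_matI) (use dims A in \<open>auto simp: X_def\<close>)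
    have "A * X * A = U * (S * (T * S) * transpose_mat V)"
      unfolding AX using dims by (subst A_eq) (simp add: mult_assoc_dim cancel)
    then show "A * X * A = A"
      using A_eq by (simp add: STS)
    have "X * A * X = V * (T * (S * T) * transpose_mat U)"
      unfolding XA using dims by (subst X_def) (simp add: mult_assoc_dim cancelV)
    then show "X * A * X = X"
      by (simp add: STS X_def)
    show "transpose_mat (A * X) = A * X"
      unfolding AX using dims sym by (simp add: transpose_mult_dim mult_assoc_dim del: assoc_mult_mat)
    show "transpose_mat (X * A) = X * A"
      unfolding XA using dims sym by (simp add: transpose_mult_dim mult_assoc_dim)
  qed
  then show ?thesis by blast
qed

lemma is_mp_mp_inv: "is_mp A (mp_inv A)"
proof -
  have "mp_inv A = (THE X. is_mp A X)"
    by (simp add: mp_inv_def is_mp_def)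
  moreover have "\<exists>!X. is_mp A X"
    using is_mp_exists is_mp_unique by blast
  ultimately show ?thesis
    using theI'[of "is_mp A"] by simp
qed

section \<open>Dual singular value decompositions and the essential part\<close>

text \<open>Rotating by \<open>1 + K eps\<close> and \<open>1 + L eps\<close> with skew
  \<open>K\<close>, \<open>L\<close> leaves the standard part alone. The dual part becomes correct
  exactly when \<open>C = T + K S - S L\<close> for \<open>C = U^T E V\<close>. The two equations on
  \<open>E\<close> confine \<open>C\<close> to the leading block of size \<open>r\<close>, where
  this can be solved entrywise.\<close>

lemma dsvd_exists:
  fixes A E Y :: "real mat"
  assumes A: "A \<in> carrier_mat m n" and E: "E \<in> carrier_mat m n" and Y: "Y \<in> carrier_mat n m"
    and AYE: "A * (Y * E) = E" and EYA: "E * (Y * A) = E"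
  shows "\<exists>U S V. dsvd (A, E) U S V"
proof -
  obtain U V d r where UV: "U \<in> carrier_mat m m" "V \<in> carrier_mat n n"
    "transpose_mat U * U = 1\<^sub>m m" "U * transpose_mat U = 1\<^sub>m m"
    "transpose_mat V * V = 1\<^sub>m n" "V * transpose_mat V = 1\<^sub>m n"
    and r: "r \<le> m" "r \<le> n" and S: "transpose_mat U * A * V = rdiag m n r d"
    and d: "\<And>l. l < r \<Longrightarrow> d l > 0" and d_mono: "\<And>i j. i \<le> j \<Longrightarrow> j < r \<Longrightarrow> d j \<le> d i"
    and C_skew: "\<And>i j. i < r \<Longrightarrow> j < r \<Longrightarrow> i \<noteq> j \<Longrightarrow> d i = d j \<Longrightarrow>
      (transpose_mat U * E * V) $$ (i, j) + (transpose_mat U * E * V) $$ (j, i) = 0"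
    and C_mono: "\<And>i j. i \<le> j \<Longrightarrow> j < r \<Longrightarrow> d i = d j \<Longrightarrow>
      (transpose_mat U * E * V) $$ (j, j) \<le> (transpose_mat U * E * V) $$ (i, i)"
    by (rule adapted_svd[OF A E]) blast
  define S where "S = rdiag m n r d"
  define C where "C = transpose_mat U * E * V"
  note C_skew = C_skew[folded C_def] and C_mono = C_mono[folded C_def]
  define c where "c = (\<lambda>i j. C $$ (i, j))"
  \<comment> \<open>On the diagonal the skew \<open>K\<close> and \<open>L\<close> contribute
    nothing, so the diagonal of \<open>C\<close> must be the dual part of the singular
    values.\<close>
  define T where "T = rdiag m n r (\<lambda>i. c i i)"
  define k where "k = (\<lambda>i j. if i < r \<and> j < r \<and> i \<noteq> j then
    (if d i = d j then c i j / d i else (c i j * d j + c j i * d i) / ((d j)\<^sup>2 - (d i)\<^sup>2)) else 0)"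
  define l where "l = (\<lambda>i j. if i < r \<and> j < r \<and> i \<noteq> j then
    (if d i = d j then 0 else (c i j * d i + c j i * d j) / ((d j)\<^sup>2 - (d i)\<^sup>2)) else 0)"
  \<comment> \<open>For unequal \<open>d i\<close>, \<open>d j\<close> these solve \<open>k i j * d j - d i * l i j = c i j\<close> and the same equation with
    \<open>i\<close>, \<open>j\<close> exchanged, subject to skewness.\<close>
  define K where "K = mat m m (\<lambda>(i, j). k i j)"
  define L where "L = mat n n (\<lambda>(i, j). l i j)"
  have dims: "dim_row A = m" "dim_col A = n" "dim_row E = m" "dim_col E = n" "dim_row Y = n" "dim_col Y = m"
    "dim_row U = m" "dim_col U = m" "dim_row V = n" "dim_col V = n"
    "dim_row S = m" "dim_col S = n" "dim_row T = m" "dim_col T = n" "dim_row C = m" "dim_col C = n"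
    "dim_row K = m" "dim_col K = m" "dim_row L = n" "dim_col L = n"
    using A E Y UV by (auto simp: S_def T_def C_def K_def L_def rdiag_def)
  have cancelU: "transpose_mat U * (U * M) = M" "U * (transpose_mat U * M) = M" if "dim_row M = m" for M
    using UV(3,4) that dims by (simp_all add: mult_assoc_dim[symmetric] unit_mult_dim del: assoc_mult_mat)
  have cancelV: "transpose_mat V * (V * M) = M" "V * (transpose_mat V * M) = M" if "dim_row M = n" for M
    using UV(5,6) that dims by (simp_all add: mult_assoc_dim[symmetric] unit_mult_dim del: assoc_mult_mat)
  have S_eq: "S = transpose_mat U * (A * V)" and C_eq: "C = transpose_mat U * (E * V)"
    using S dims by (simp_all add: S_def C_def mult_assoc_dim)
  \<comment> \<open>Factoring \<open>S\<close> out on the left kills the rows of \<open>C\<close>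
    from \<open>r\<close> on; \<open>C_right\<close> does the same for the columns.\<close>
  have C_left: "C = S * (transpose_mat V * (Y * (E * V)))"
    unfolding S_eq C_eq using dims AYE by (simp add: mult_assoc_dim cancelV)
      (simp add: mult_assoc_dim[symmetric])
  have C_right: "C = (transpose_mat U * (E * (Y * U))) * S"
    unfolding S_eq C_eq using dims EYA by (simp add: mult_assoc_dim cancelU)
      (simp add: mult_assoc_dim[symmetric])
  have c_zero: "c i j = 0" if "i < m" "j < n" "\<not> (i < r \<and> j < r)" for i j
  proof (cases "i < r")
    case False
    have "C $$ (i, j) = (S * (transpose_mat V * (Y * (E * V)))) $$ (i, j)"
      using C_left by (rule arg_cong)
    also have "\<dots> = 0"
      unfolding S_def using False that dims r by (subst rdiag_mult_index[of _ n n]) auto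
    finally show ?thesis by (simp add: c_def)
  next
    case True
    have "C $$ (i, j) = ((transpose_mat U * (E * (Y * U))) * S) $$ (i, j)"
      using C_right by (rule arg_cong)
    also have "\<dots> = 0"
      unfolding S_def using True that dims r by (subst mult_rdiag_index[of _ m m]) auto
    finally show ?thesis by (simp add: c_def)
  qed
  \<comment> \<open>For unequal singular values the exchange of \<open>i\<close> and
    \<open>j\<close> only flips the sign of the denominator. For equal ones the two equations are
    compatible only if \<open>C\<close> is skew there, which the adapted bases ensure.\<close>
  have skew_k: "k j i = - k i j" and skew_l: "l j i = - l i j" for i j
    using C_skew[of i j]
    by (auto simp: k_def l_def c_def divide_simps algebra_simps eq_neg_iff_add_eq_0)
  have K_skew: "transpose_mat K = - K" and L_skew: "transpose_mat L = - L"
    by (auto simp: K_def L_def intro!: eq_matI skew_k skew_l)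
  have kl: "c i j + d i * l i j = k i j * d j" if "i < r" "j < r" "i \<noteq> j" for i j
  proof (cases "d i = d j")
    case True
    then show ?thesis using that d[of j] by (simp add: k_def l_def)
  next
    case False
    then have "(d j)\<^sup>2 - (d i)\<^sup>2 \<noteq> 0"
      using d[of i] d[of j] that by (simp add: power2_eq_iff_nonneg)
    then show ?thesis
      using that False by (simp add: k_def l_def field_simps power2_eq_square)
  qed
  have sylvester: "C + S * L = T + K * S"
  proof (rule eq_matI)
    fix i j assume "i < dim_row (T + K * S)" "j < dim_col (T + K * S)"
    then have ij: "i < m" "j < n" using dims by auto
    have "(S * L) $$ (i, j) = (if i < r then d i * l i j else 0)"
      unfolding S_def using ij r by (subst rdiag_mult_index[of _ n n]) (auto simp: L_def)
    moreover have "(K * S) $$ (i, j) = (if j < r then k i j * d j else 0)"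
      unfolding S_def using ij r by (subst mult_rdiag_index[of _ m m]) (auto simp: K_def)
    moreover have "C $$ (i, j) = c i j" "T $$ (i, j) = (if i = j \<and> i < r then c i i else 0)"
      using ij by (auto simp: c_def T_def rdiag_def)
    moreover have "k i j = 0 \<and> l i j = 0" if "i = j \<or> \<not> (i < r \<and> j < r)"
      using that by (auto simp: k_def l_def)
    ultimately show "(C + S * L) $$ (i, j) = (T + K * S) $$ (i, j)"
      using ij dims kl[of i j] c_zero[OF ij] by (cases "i = j"; cases "i < r"; cases "j < r") auto
  qed (use dims in auto)
  \<comment> \<open>The dual part of the orthogonality relation is \<open>K^T + K = 0\<close>, up to
    conjugation by \<open>U\<close>.\<close>
  have orthU: "dorthogonal m (U, U * K)"
    unfolding dorthogonal_def dmult_def dtrans_def did_def dcarrier_def using UV dims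
    by (auto simp: mat_dim_simps K_skew cancelU)
  have orthV: "dorthogonal n (V, V * L)"
    unfolding dorthogonal_def dmult_def dtrans_def did_def dcarrier_def using UV dims
    by (auto simp: mat_dim_simps L_skew cancelV)
  have "dsvd_sigma m n (S, T)"
    unfolding dsvd_sigma_def
  proof (intro conjI)
    show "(S, T) \<in> dcarrier m n"
      by (simp add: dcarrier_def S_def T_def)
    show "\<forall>i<m. \<forall>j<n. i \<noteq> j \<longrightarrow> fst (S, T) $$ (i, j) = 0 \<and> snd (S, T) $$ (i, j) = 0"
      by (simp add: S_def T_def rdiag_def)
    show "\<exists>r t. r \<le> t \<and> t \<le> min m n \<and>
        (\<forall>i<r. fst (S, T) $$ (i, i) > 0) \<and>
        (\<forall>i. r \<le> i \<and> i < t \<longrightarrow> fst (S, T) $$ (i, i) = 0 \<and> snd (S, T) $$ (i, i) > 0) \<and>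
        (\<forall>i. t \<le> i \<and> i < min m n \<longrightarrow> fst (S, T) $$ (i, i) = 0 \<and> snd (S, T) $$ (i, i) = 0)"
      \<comment> \<open>Both indices are \<open>r\<close>: this decomposition has no infinitesimal
        singular values.\<close>
      by (intro exI[of _ r]) (use r d in \<open>auto simp: S_def T_def rdiag_def\<close>)
    show "\<forall>i j. i \<le> j \<and> j < min m n \<longrightarrow> dual_le (ddiag_entry (S, T) j) (ddiag_entry (S, T) i)"
    proof (intro allI impI)
      fix i j assume ij: "i \<le> j \<and> j < min m n"
      then have entries: "ddiag_entry (S, T) i = (if i < r then (d i, c i i) else (0, 0))"
        "ddiag_entry (S, T) j = (if j < r then (d j, c j j) else (0, 0))"
        by (auto simp: ddiag_entry_def S_def T_def rdiag_def)
      \<comment> \<open>Ties among the standard parts are settled by \<open>C_mono\<close>, which is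
        why the bases were chosen with decreasing diagonal of \<open>C\<close>.\<close>
      show "dual_le (ddiag_entry (S, T) j) (ddiag_entry (S, T) i)"
        unfolding entries dual_le_def
        using ij d[of i] d_mono[of i j] C_mono[of i j]
        by (cases "d i = d j") (auto simp: c_def)
    qed
  qed
  moreover have "(A, E) = dmult (dmult (U, U * K) (S, T)) (dtrans (V, V * L))"
  proof -
    have "U * (S * transpose_mat V) = A"
      unfolding S_eq using dims UV(6) by (simp add: mult_assoc_dim cancelU unit_mult_dim)
    moreover have "U * S * transpose_mat (V * L) + (U * T + U * K * S) * transpose_mat V = E"
    proof -
      define R where "R = U * (S * (L * transpose_mat V))"
      have "U * S * transpose_mat (V * L) = - R"
        unfolding R_def using dims by (simp add: mult_assoc_dim transpose_mult_dim L_skew)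
      moreover have "(U * T + U * K * S) * transpose_mat V = U * (C * transpose_mat V) + R"
      proof -
        have "(U * T + U * K * S) * transpose_mat V = U * ((T + K * S) * transpose_mat V)"
          using dims by (simp add: mult_assoc_dim mult_add_dim add_mult_dim)
        also have "\<dots> = U * (C * transpose_mat V) + R"
          unfolding sylvester[symmetric] R_def using dims
          by (simp add: mult_assoc_dim mult_add_dim add_mult_dim)
        finally show ?thesis .
      qed
      moreover have "U * (C * transpose_mat V) = E"
        unfolding C_eq using dims UV(6) by (simp add: mult_assoc_dim cancelU unit_mult_dim)
      moreover have "- R + (E + R) = E"
        using dims by (intro eq_matI) (auto simp: R_def)
      ultimately show ?thesis by simp
    qed
    ultimately show ?thesis
      using dims by (simp add: dmult_def dtrans_def mult_assoc_dim)
  qed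
  ultimately have "dsvd (A, E) (U, U * K) (S, T) (V, V * L)"
    unfolding dsvd_def Let_def fst_conv dims(1,2) using orthU orthV by blast
  then show ?thesis by blast
qed

lemma ess_sigma_eq_self:
  assumes "dsvd_sigma m n S"
    and "\<And>i. i < m \<Longrightarrow> i < n \<Longrightarrow> fst S $$ (i, i) = 0 \<Longrightarrow> snd S $$ (i, i) = 0"
  shows "ess_sigma S = S"
proof (rule prod_eqI)
  have S: "dim_row (fst S) = m" "dim_col (fst S) = n" "dim_row (snd S) = m" "dim_col (snd S) = n"
    "\<forall>i<m. \<forall>j<n. i \<noteq> j \<longrightarrow> fst S $$ (i, j) = 0 \<and> snd S $$ (i, j) = 0"
    using assms(1) by (auto simp: dsvd_sigma_def dcarrier_def)
  show "fst (ess_sigma S) = fst S" "snd (ess_sigma S) = snd S"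
    using S assms(2) by (auto simp: ess_sigma_def Let_def intro!: eq_matI) metis+
qed

text \<open>If the standard part of entry \<open>i\<close> is zero, then row \<open>i\<close> and
  column \<open>i\<close> of the standard part of \<open>S\<close> vanish. Each summand in the dual
  part of \<open>S Z S\<close> at \<open>(i, i)\<close> contains one of them as an outer
  factor.\<close>

lemma dsvd_sigma_no_infinitesimal:
  assumes S: "dsvd_sigma m n S" and Z: "Z \<in> dcarrier n m" and SZS: "dmult (dmult S Z) S = S"
    and i: "i < m" "i < n" "fst S $$ (i, i) = 0"
  shows "snd S $$ (i, i) = 0"
proof -
  have dims: "dim_row (fst S) = m" "dim_col (fst S) = n" "dim_row (snd S) = m" "dim_col (snd S) = n"
    and off: "\<forall>i<m. \<forall>j<n. i \<noteq> j \<longrightarrow> fst S $$ (i, j) = 0"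
    using S by (auto simp: dsvd_sigma_def dcarrier_def)
  note dimsZ = dcarrierD[OF Z]
  have row: "row (fst S) i = 0\<^sub>v n" and col: "col (fst S) i = 0\<^sub>v m"
    using off i dims by (auto intro!: eq_vecI) metis+
  have "row (fst S * fst Z) i = 0\<^sub>v m"
    using i dims dimsZ row by (auto intro!: eq_vecI simp: scalar_prod_def)
  then have "snd (dmult (dmult S Z) S) $$ (i, i) = 0"
    using i dims dimsZ col by (simp add: dmult_def scalar_prod_def)
  then show ?thesis by (simp add: SZS)
qed

text \<open>The choice operator may return the essential part from any decomposition, so the
  argument treats an arbitrary one. The equation \<open>BXB = B\<close> rules out infinitesimal
  entries in its middle factor.\<close>

lemma essential_part_eq_self:
  assumes B: "B \<in> dcarrier m n" and X: "X \<in> dcarrier n m" and BXB: "dmult (dmult B X) B = B"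
    and ex: "\<exists>U S V. dsvd B U S V"
  shows "essential_part B = B"
proof -
  have "\<exists>Be U S V. dsvd B U S V \<and> Be = dmult (dmult U (ess_sigma S)) (dtrans V)"
    using ex by blast
  from someI_ex[OF this]
  have "\<exists>U S V. dsvd B U S V \<and> essential_part B = dmult (dmult U (ess_sigma S)) (dtrans V)"
    unfolding essential_part_def .
  then obtain U S V where svd: "dsvd B U S V"
    and ess: "essential_part B = dmult (dmult U (ess_sigma S)) (dtrans V)" by blast
  have orth: "dorthogonal m U" "dorthogonal n V" and sig: "dsvd_sigma m n S"
    and B_eq: "B = dmult (dmult U S) (dtrans V)"
    using svd dcarrierD[OF B] by (auto simp: dsvd_def Let_def)
  have U: "U \<in> dcarrier m m" and V: "V \<in> dcarrier n n" and S: "S \<in> dcarrier m n"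
    using orth sig by (auto simp: dorthogonal_def dsvd_sigma_def)
  note Ut = dtrans_carrier[OF U] and Vt = dtrans_carrier[OF V]
  have UtU: "dmult (dtrans U) U = did m" "dmult U (dtrans U) = did m"
    and VtV: "dmult (dtrans V) V = did n" "dmult V (dtrans V) = did n"
    using orth by (auto simp: dorthogonal_def)
  \<comment> \<open>Conjugating \<open>X\<close> by the orthogonal factors turns
    \<open>BXB = B\<close> into \<open>SZS = S\<close>.\<close>
  define Z where "Z = dmult (dmult (dtrans V) X) U"
  have VtX: "dmult (dtrans V) X \<in> dcarrier n m" by (rule dmult_carrier[OF Vt X])
  have Z: "Z \<in> dcarrier n m" unfolding Z_def by (rule dmult_carrier[OF VtX U])
  note US = dmult_carrier[OF U S]
  note BV = dmult_carrier[OF B V] and BX = dmult_carrier[OF B X]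
  have US_eq: "dmult U S = dmult B V"
    unfolding B_eq dmult_assoc[OF US Vt V] VtV by (simp add: dmult_did[OF US])
  have S_eq: "S = dmult (dtrans U) (dmult B V)"
    unfolding US_eq[symmetric] dmult_assoc[OF Ut U S, symmetric] UtU by (simp add: dmult_did[OF S])
  have "dmult (dmult B V) Z = dmult (dmult B X) U"
    unfolding Z_def dmult_assoc[OF Vt X U] dmult_assoc[OF BV Vt dmult_carrier[OF X U], symmetric]
      dmult_assoc[OF B V Vt] VtV dmult_did[OF B] dmult_assoc[OF B X U] ..
  then have "dmult (dmult (dmult B V) Z) S = dmult (dmult B X) (dmult B V)"
    by (simp add: dmult_assoc[OF BX U S] US_eq)
  also have "\<dots> = dmult B V"
    unfolding dmult_assoc[OF BX B V, symmetric] BXB ..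
  finally have "dmult (dtrans U) (dmult (dmult (dmult B V) Z) S) = S"
    using S_eq by simp
  then have "dmult (dmult S Z) S = S"
    using dmult_assoc[OF Ut dmult_carrier[OF BV Z] S] dmult_assoc[OF Ut BV Z] S_eq by simp
  then have "ess_sigma S = S"
    using ess_sigma_eq_self[OF sig] dsvd_sigma_no_infinitesimal[OF sig Z] by blast
  then show ?thesis using ess B_eq by simp
qed

section \<open>Penrose equations for the MPDGI and equality of the inverses\<close>

lemma is_dmpgi_mpdgi:
  assumes A: "A \<in> carrier_mat m n" and E: "E \<in> carrier_mat m n"
    and AYE: "A * (mp_inv A * E) = E" and EYA: "E * (mp_inv A * A) = E"
  shows "is_dmpgi (A, E) (mpdgi (A, E))"
proof -
  define Y where "Y = mp_inv A"
  have mp: "is_mp A Y" unfolding Y_def by (rule is_mp_mp_inv)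
  have dims: "dim_row A = m" "dim_col A = n" "dim_row E = m" "dim_col E = n" "dim_row Y = n" "dim_col Y = m"
    using A E mp by (auto simp: is_mp_def)
  have AYA: "A * (Y * A) = A" and YAY: "Y * (A * Y) = Y"
    and sym: "transpose_mat (A * Y) = A * Y" "transpose_mat (Y * A) = Y * A"
    using mp dims by (auto simp: is_mp_def mult_assoc_dim)
  note AYE = AYE[folded Y_def] and EYA = EYA[folded Y_def]
  have AYEY: "A * (Y * (E * Y)) = E * Y"
    using AYE dims by (simp add: mult_assoc_dim[symmetric])
  \<comment> \<open>The dual part is \<open>E Y - A Y E Y\<close>, which cancels because
    \<open>A Y E = E\<close>. So \<open>BX\<close>, and likewise \<open>XB\<close>, is a real
    orthogonal projection, and symmetry is inherited from \<open>Y\<close>.\<close>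
  have BX: "dmult (A, E) (Y, - (Y * E * Y)) = (A * Y, 0\<^sub>m m m)"
    using dims AYEY by (simp add: dmult_def mat_dim_simps)
  have XB: "dmult (Y, - (Y * E * Y)) (A, E) = (Y * A, 0\<^sub>m n n)"
    using dims EYA by (simp add: dmult_def mat_dim_simps)
  have "is_dmpgi (A, E) (Y, - (Y * E * Y))"
    unfolding is_dmpgi_def BX XB
    using dims AYA YAY sym AYE AYEY
    by (auto simp: dmult_def dtrans_def mat_dim_simps dcarrier_def)
  then show ?thesis by (simp add: mpdgi_def Y_def)
qed

theorem theorem5p3:
  fixes A :: dmat and m n :: nat
  assumes "A \<in> dcarrier m n"
  defines "A1 \<equiv> dmult (dmult (dreal (fst A * mp_inv (fst A))) A) (dreal (mp_inv (fst A) * fst A))"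
  shows "dmpgi_exists A1 \<and> mpdgi A = mpdgi A1 \<and> mpdgi A1 = dmpgi A1 \<and> dmpgi A1 = gmpi A1"
proof -
  define As Ad Y where "As = fst A" and "Ad = snd A" and "Y = mp_inv As"
  have mp: "is_mp As Y" unfolding Y_def by (rule is_mp_mp_inv)
  have dims: "dim_row As = m" "dim_col As = n" "dim_row Ad = m" "dim_col Ad = n" "dim_row Y = n" "dim_col Y = m"
    using dcarrierD[OF assms(1)] mp by (auto simp: is_mp_def As_def Ad_def)
  have AYA: "As * (Y * As) = As" and YAY: "Y * (As * Y) = Y"
    using mp dims by (auto simp: is_mp_def mult_assoc_dim)
  have AYA': "As * (Y * (As * M)) = As * M" if "dim_row M = n" for M
    using AYA dims that by (simp add: mult_assoc_dim[symmetric])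
  have YAY': "Y * (As * (Y * M)) = Y * M" if "dim_row M = m" for M
    using YAY dims that by (simp add: mult_assoc_dim[symmetric])
  \<comment> \<open>The dual part compressed between the projections \<open>As Y\<close> and
    \<open>Y As\<close>. The same compression fixes \<open>As\<close>, so
    \<open>A1 = (As, E)\<close>.\<close>
  define E where "E = As * (Y * (Ad * (Y * As)))"
  have dimE: "dim_row E = m" "dim_col E = n" using dims by (auto simp: E_def)
  have A1: "A1 = (As, E)"
    unfolding A1_def As_def[symmetric] Y_def[symmetric] E_def
    using dims by (simp add: dmult_def dreal_def As_def[symmetric] Ad_def[symmetric] mat_dim_simps AYA)
  have AYE: "As * (Y * E) = E" and EYA: "E * (Y * As) = E"
    unfolding E_def using dims by (simp_all add: mult_assoc_dim YAY' AYA)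
  have carr: "As \<in> carrier_mat m n" "E \<in> carrier_mat m n" "Y \<in> carrier_mat n m"
    using dims dimE by auto
  have A1_carr: "A1 \<in> dcarrier m n"
    using carr by (simp add: A1 dcarrier_def)
  have dmp: "is_dmpgi A1 (mpdgi A1)"
    unfolding A1 by (rule is_dmpgi_mpdgi[OF carr(1,2) AYE[unfolded Y_def] EYA[unfolded Y_def]])
  have D: "dmpgi A1 = mpdgi A1"
    unfolding dmpgi_def using dmp is_dmpgi_unique[OF _ dmp A1_carr] by (rule the_equality)
  have "mpdgi A1 \<in> dcarrier n m" "dmult (dmult A1 (mpdgi A1)) A1 = A1"
    using dmp dcarrierD[OF A1_carr] by (auto simp: is_dmpgi_def)
  then have "essential_part A1 = A1"
    using dsvd_exists[OF carr AYE EYA, folded A1] by (rule essential_part_eq_self[OF A1_carr])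
  \<comment> \<open>With \<open>A1\<close> as its own essential part, the two definite descriptions
    have the same body.\<close>
  then have G: "gmpi A1 = dmpgi A1"
    by (simp add: gmpi_def dmpgi_def is_dmpgi_def)
  \<comment> \<open>\<open>Y\<close> absorbs both projections, so the MPDGI sees only the compressed
    dual part.\<close>
  have "Y * (E * Y) = Y * (Ad * Y)"
    unfolding E_def using dims YAY by (simp add: mult_assoc_dim YAY')
  then have "mpdgi A = mpdgi A1"
    using dims dimE by (simp add: mpdgi_def A1 As_def[symmetric] Ad_def[symmetric] Y_def[symmetric] mult_assoc_dim)
  with dmp D G show ?thesis
    unfolding dmpgi_exists_def by metis
qed

end
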